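(* Let $\beta,L>0$ and $\alpha\in(0,1)$. Consider the regression model $Y_i=l(X_i)+\varepsilon_i$, $i=1,\ldots,n$, with independent identically distributed errors having a Lebesgue density $f$ symmetric about $0$. Assume: (i) $X_i=H^{-1}(i/n)$, $i=1,\ldots,n$, where $H$ is the distribution function of a strictly positive and continuous Lebesgue probability density $h$ on $[0,1]$ of finite total variation; (ii) $f$ is strictly positive and absolutely continuous on $\mathbb{R}$ with finite Fisher information $I(f):=\int\left(\frac{f'(x)}{f(x)}\right)^2f(x)\,dx$; (iii) there exists a constant $\delta_0>0$ such that $$\int \left\{ \left(\frac{f(z+\theta)}{f(z)}\right)^{1+\delta} - 1 \right\} f(z)\, dz = \frac{1}{2}\delta(1+\delta)\theta^2 I(f)\,(1 + r(\theta, \delta))$$ with $r(\theta,\delta)=O(1/\log(1/|\theta|))$ as $|\theta|\to0$, uniformly in $\delta\in(0,\delta_0]$. Let $\rho_n:=((\log n)/n)^{\beta/(2\beta+1)}$ and $$d_* := \left(\frac{2L^{1/\beta}}{(2\beta+1)I(f)\|\gamma_\beta\|_2^2}\right)^{\beta/(2\beta+1)}.$$ Then for arbitrary numbers $\varepsilon_n>0$ with $\lim_{n\to\infty}\varepsilon_n=0$ and $\lim_{n\to\infty}(\log n)^{1/2}\varepsilon_n=\infty$, $$\limsup_{n\to\infty}\ \inf_{\substack{l\in\mathcal{H}_h(\beta,L):\\ \|l\sqrt{h}\|_J\geq(1-\varepsilon_n)d_*\rho_n}}\mathbb{E}_l\,\phi_n(Y)\leq\alpha$$ for any fixed nondegenerate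 interval $J\subset[0,1]$ and arbitrary tests $\phi_n$ (of the hypothesis $l=0$) at significance level $\leq\alpha$.
   Context: Hölder classes: for an interval $I\subset\mathbb{R}$ and $\beta,L>0$, if $0<\beta\le1$, $\mathcal{H}(\beta,L;I):=\{g:I\to\mathbb{R}\mid |g(x)-g(y)|\le L|x-y|^\beta\ \text{for all }x,y\in I\}$; if $k<\beta\le k+1$ for an integer $k\ge1$, $\mathcal{H}(\beta,L;I)$ is the set of functions on $I$ that are $k$ times differentiable and whose $k$th derivative belongs to $\mathcal{H}(\beta-k,L;I)$. Given the design density $h$, $\mathcal{H}_h(\beta,L):=\{g/\sqrt h\mid g\in\mathcal{H}(\beta,L;[0,1])\}$. $\gamma_\beta$ denotes the solution of the minimization problem: minimize $\|\gamma\|_2$ over all $\gamma\in\mathcal{H}(\beta,1;\mathbb{R})$ with $\gamma(0)\ge1$. It is known that $\gamma_\beta$ is an even function with compact support and $\gamma_\beta(0)=1>|\gamma_\beta(x)|$ for $x\ne0$. The norm $\|\cdot\|_2$ is the $L_2$-norm with respect to Lebesgue measure. For $J\subset[0,1]$, $\|g\|_J:=\sup_{x\in J}|g(x)|$. $\mathbb{E}_l$ denotes expectation when the regression function is $l$, and $Y=(Y_1,\ldots,Y_n)$; the design points are deterministic and depend on $n$. A test $\phi_n$ is a measurable function from the sample space $\mathbb{R}^n$ to $[0,1]$; it has significance level $\le\alpha$ if $\mathbb{E}_0\phi_n(Y)\le\alpha$, where the subscript $0$ refers to $l=0$. *)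

theory Defs
  imports "HOL-Probability.Probability"
begin

text \<open>
  Functions on an interval \<open>I\<close> are represented by total functions of which only the values on \<open>I\<close>
  matter. For \<open>\<beta> > 0\<close> there is exactly one \<open>k\<close> with \<open>k < \<beta> \<le> k + 1\<close>; for \<open>\<beta> \<le> 1\<close> it is \<open>0\<close>.
  \<open>D j\<close> is the \<open>j\<close>th derivative, one-sided at end points belonging to \<open>I\<close>.
\<close>

definition holder_class :: "real \<Rightarrow> real \<Rightarrow> real set \<Rightarrow> (real \<Rightarrow> real) set" where
  "holder_class \<beta> L I = {g. \<exists>k::nat. real k < \<beta> \<and> \<beta> \<le> real k + 1 \<and>
     (\<exists>D :: nat \<Rightarrow> real \<Rightarrow> real.
        (\<forall>x\<in>I. D 0 x = g x) \<and>
        (\<forall>j<k. \<forall>x\<in>I. (D j has_real_derivative D (Suc j) x) (at x within I)) \<and>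
        (\<forall>x\<in>I. \<forall>y\<in>I. \<bar>D k x - D k y\<bar> \<le> L * \<bar>x - y\<bar> powr (\<beta> - real k)))}"

definition weighted_holder_class :: "(real \<Rightarrow> real) \<Rightarrow> real \<Rightarrow> real \<Rightarrow> (real \<Rightarrow> real) set" where
  "weighted_holder_class h \<beta> L = {\<lambda>x. g x / sqrt (h x) | g. g \<in> holder_class \<beta> L {0..1}}"

definition L2_norm :: "(real \<Rightarrow> real) \<Rightarrow> real" where
  "L2_norm g = sqrt (LINT x|lborel. (g x)\<^sup>2)"

text \<open>
  Since the Bochner integral of a non-integrable function is \<open>0\<close>, competitors of infinite
  \<open>L\<^sub>2\<close>-norm have to be excluded explicitly.
\<close>

definition minimal_norm_solution :: "real \<Rightarrow> (real \<Rightarrow> real) \<Rightarrow> bool" where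
  "minimal_norm_solution \<beta> \<gamma> \<longleftrightarrow>
     \<gamma> \<in> holder_class \<beta> 1 UNIV \<and> \<gamma> 0 \<ge> 1 \<and> integrable lborel (\<lambda>x. (\<gamma> x)\<^sup>2) \<and>
     (\<forall>g \<in> holder_class \<beta> 1 UNIV. g 0 \<ge> 1 \<and> integrable lborel (\<lambda>x. (g x)\<^sup>2)
        \<longrightarrow> L2_norm \<gamma> \<le> L2_norm g)"

definition sup_norm_on :: "real set \<Rightarrow> (real \<Rightarrow> real) \<Rightarrow> real" where
  "sup_norm_on J g = (SUP x\<in>J. \<bar>g x\<bar>)"

definition finite_total_variation_on :: "real set \<Rightarrow> (real \<Rightarrow> real) \<Rightarrow> bool" where
  "finite_total_variation_on S g \<longleftrightarrow>
     (\<exists>V. \<forall>(m::nat) (t :: nat \<Rightarrow> real). (\<forall>i\<le>m. t i \<in> S) \<and> mono_on {..m} t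
        \<longrightarrow> (\<Sum>i<m. \<bar>g (t (Suc i)) - g (t i)\<bar>) \<le> V)"

definition abs_continuous_on :: "real set \<Rightarrow> (real \<Rightarrow> real) \<Rightarrow> bool" where
  "abs_continuous_on S g \<longleftrightarrow>
     (\<forall>e>0. \<exists>d>0. \<forall>(m::nat) (a :: nat \<Rightarrow> real) (b :: nat \<Rightarrow> real).
        (\<forall>i<m. a i \<le> b i \<and> {a i..b i} \<subseteq> S) \<and>
        disjoint_family_on (\<lambda>i. {a i<..<b i}) {..<m} \<and>
        (\<Sum>i<m. b i - a i) < d
        \<longrightarrow> (\<Sum>i<m. \<bar>g (b i) - g (a i)\<bar>) < e)"

text \<open>
  An absolutely continuous density is differentiable almost everywhere, so the values of
  \<^term>\<open>deriv\<close> at the remaining points are irrelevant.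
\<close>

definition fisher_integrand :: "(real \<Rightarrow> real) \<Rightarrow> real \<Rightarrow> real" where
  "fisher_integrand f x = (deriv f x / f x)\<^sup>2 * f x"

definition fisher_information :: "(real \<Rightarrow> real) \<Rightarrow> real" where
  "fisher_information f = (LINT x|lborel. fisher_integrand f x)"

definition design_cdf :: "(real \<Rightarrow> real) \<Rightarrow> real \<Rightarrow> real" where
  "design_cdf h = cdf (density lborel (\<lambda>x. ennreal (h x) * indicator {0..1} x))"

definition design_point :: "(real \<Rightarrow> real) \<Rightarrow> nat \<Rightarrow> nat \<Rightarrow> real" where
  "design_point h n i = the_inv_into {0..1} (design_cdf h) (real i / real n)"

text \<open>The sample \<open>(Y\<^sub>1, \<dots>, Y\<^sub>n)\<close> as a point of the product space indexed by \<open>{1..n}\<close>.\<close>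

definition sample ::
    "(real \<Rightarrow> real) \<Rightarrow> (nat \<Rightarrow> 'a \<Rightarrow> real) \<Rightarrow> nat \<Rightarrow> (real \<Rightarrow> real) \<Rightarrow> 'a \<Rightarrow> nat \<Rightarrow> real" where
  "sample h \<epsilon> n l \<omega> = (\<lambda>i\<in>{1..n}. l (design_point h n i) + \<epsilon> i \<omega>)"

definition expectation_under ::
    "'a measure \<Rightarrow> (real \<Rightarrow> real) \<Rightarrow> (nat \<Rightarrow> 'a \<Rightarrow> real) \<Rightarrow> nat \<Rightarrow> (real \<Rightarrow> real)
      \<Rightarrow> ((nat \<Rightarrow> real) \<Rightarrow> real) \<Rightarrow> real" where
  "expectation_under M h \<epsilon> n l \<phi> = (LINT \<omega>|M. \<phi> (sample h \<epsilon> n l \<omega>))"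

definition is_test :: "nat \<Rightarrow> ((nat \<Rightarrow> real) \<Rightarrow> real) \<Rightarrow> bool" where
  "is_test n \<phi> \<longleftrightarrow> \<phi> \<in> borel_measurable (\<Pi>\<^sub>M i\<in>{1..n}. borel) \<and>
     (\<forall>y \<in> space (\<Pi>\<^sub>M i\<in>{1..n}. (borel :: real measure)). 0 \<le> \<phi> y \<and> \<phi> y \<le> 1)"

definition rate :: "real \<Rightarrow> nat \<Rightarrow> real" where
  "rate \<beta> n = (ln (real n) / real n) powr (\<beta> / (2 * \<beta> + 1))"

definition d_star :: "real \<Rightarrow> real \<Rightarrow> (real \<Rightarrow> real) \<Rightarrow> (real \<Rightarrow> real) \<Rightarrow> real" where
  "d_star \<beta> L f \<gamma> =
     (2 * L powr (1 / \<beta>) / ((2 * \<beta> + 1) * fisher_information f * (L2_norm \<gamma>)\<^sup>2))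
       powr (\<beta> / (2 * \<beta> + 1))"

end

theory Submission
  imports Defs "HOL-Real_Asymp.Real_Asymp"
begin

text \<open>
  The proof compares the null hypothesis with a mixture. Take a bump \<open>a * g ((x - t) / b)\<close>, where \<open>g\<close> is nearly the
  extremal function \<open>\<gamma>\<close>, with the height \<open>a = (1 - \<epsilon>\<^sub>n) * d\<^sub>* * \<rho>\<^sub>n\<close> and the width \<open>b\<close> that
  the Hoelder constant \<open>L\<close> prescribes. About \<open>m\<close> such bumps with disjoint supports fit into \<open>J\<close>, and
  \<open>ln m\<close> is \<open>ln n / (2 * \<beta> + 1)\<close> to first order. Divided by \<open>sqrt h\<close>, each of them is an admissible
  alternative, and the average of their likelihood ratios is the likelihood ratio of the mixture. If this
  average is close to \<open>1\<close> in the mean, no test can have a power exceeding its level substantially against all of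
  the bumps (\<open>exists_undetectable_shift\<close>).

  The likelihood ratios are independent because the supports are disjoint, and the average of \<open>m\<close> independent
  variables with mean \<open>1\<close> is close to \<open>1\<close> once their moments of order \<open>1 + \<delta>\<close> are small compared to \<open>m powr \<delta>\<close>
  (\<open>exists_weight_with_small_expectation\<close>). By the moment expansion of the density ratio, this moment is at most the exponential of
  \<open>\<delta> * (1 + \<delta>) * I(f) / 2\<close> times the sum of the squared values of the bump at the design points, up to a relative error
  \<open>O(1 / ln n)\<close>. The sum is \<open>n * a\<^sup>2 * b\<close> times the squared \<open>L\<^sub>2\<close>-norm of \<open>g\<close>, up to an error controlled by the
  total variation of \<open>h\<close> and the modulus of continuity of \<open>g\<close> (\<open>design_sum_bump_le\<close>). The constant \<open>d\<^sub>*\<close> is such that,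
  without the factor \<open>1 - \<epsilon>\<^sub>n\<close>, half the Fisher information times this energy would be \<open>ln n / (2 * \<beta> + 1)\<close>
  (\<open>signal_energy_eq\<close>). With this factor and \<open>\<delta> = \<epsilon>\<^sub>n / 2\<close>, the logarithm of \<open>m powr \<delta>\<close> divided by the moment is of
  order \<open>\<epsilon>\<^sub>n\<^sup>2 * ln n\<close>, which tends to infinity (\<open>likelihood_moment_negligible\<close>).

  For the supports to be disjoint, \<open>\<gamma>\<close> is cut off at the distance \<open>exp (sqrt (ln n))\<close> from \<open>0\<close>
  (\<open>compactly_supported_competitor\<close>). This lowers \<open>ln m\<close> and raises the energy so little that
  \<open>\<epsilon>\<^sub>n\<close> absorbs both. The cutoff costs little because a square integrable function in a
  Hoelder class has bounded derivatives (\<open>square_integrable_all_derivatives_bounded\<close>).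
\<close>

section \<open>Bounded derivatives of square integrable Hoelder functions\<close>

text \<open>
  By the mean value theorem \<^term>\<open>\<bar>F x - F y\<bar> \<ge> M * \<bar>x - y\<bar>\<close> on the interval. If
  \<^term>\<open>\<bar>F p\<bar> < M * l / 4\<close> for some \<^term>\<open>p\<close> in the first quarter, then the last quarter, at distance at least
  \<^term>\<open>l / 2\<close> from \<^term>\<open>p\<close>, serves; otherwise the first quarter does.
\<close>

lemma steep_imp_large_on_quarter:
  fixes F F' :: "real \<Rightarrow> real"
  assumes der: "\<And>x. (F has_real_derivative F' x) (at x)"
    and M: "M \<ge> 0" and l: "l > 0"
    and large: "\<And>x. x \<in> {a..a + l} \<Longrightarrow> \<bar>F' x\<bar> \<ge> M"
  shows "\<exists>a'. \<forall>x\<in>{a'..a' + l / 4}. x \<in> {a..a + l} \<and> \<bar>F x\<bar> \<ge> M * l / 4"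
proof -
  have inc: "\<bar>F y - F x\<bar> \<ge> M * (y - x)" if "a \<le> x" "x < y" "y \<le> a + l" for x y
  proof -
    obtain z where z: "z > x" "z < y" "F y - F x = (y - x) * F' z"
      using MVT2[OF \<open>x < y\<close>, of F F'] der by blast
    have "\<bar>F y - F x\<bar> = (y - x) * \<bar>F' z\<bar>" using z that by (simp add: abs_mult)
    moreover have "M \<le> \<bar>F' z\<bar>" using large[of z] z that by auto
    ultimately show ?thesis using that by (simp add: mult.commute mult_left_mono)
  qed
  show ?thesis
  proof (cases "\<forall>x\<in>{a..a + l / 4}. \<bar>F x\<bar> \<ge> M * l / 4")
    case True
    then show ?thesis using l by (intro exI[of _ a]) auto
  next
    case False
    then obtain p where p: "a \<le> p" "p \<le> a + l / 4" "\<bar>F p\<bar> < M * l / 4" by auto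
    have "x \<in> {a..a + l} \<and> \<bar>F x\<bar> \<ge> M * l / 4" if x: "x \<in> {a + 3 * l / 4..a + 3 * l / 4 + l / 4}" for x
    proof -
      have xx: "x \<ge> a + 3 * l / 4" "x \<le> a + l" using x by (auto simp: field_simps)
      have "M * (l / 2) \<le> M * (x - p)" using xx p M by (intro mult_left_mono) auto
      also have "\<dots> \<le> \<bar>F x - F p\<bar>" using inc[of p x] xx p l by auto
      finally have "\<bar>F x\<bar> \<ge> M * l / 4" using p(3) by (auto simp: abs_if split: if_splits)
      then show ?thesis using xx l by auto
    qed
    then show ?thesis by blast
  qed
qed

text \<open>
  Descending from the \<open>m\<close>th derivative to the function costs a factor \<open>4\<close> in length and a factor
  proportional to the length in height at each step. What matters is that the constants \<open>l'\<close> and \<open>c\<close>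
  are the same for all functions, positions and heights.
\<close>

lemma derivative_large_imp_function_large:
  assumes "l > 0"
  shows "\<exists>l'>0. \<exists>c>0. \<forall>(D :: nat \<Rightarrow> real \<Rightarrow> real) a M.
           (\<forall>j<m. \<forall>x. (D j has_real_derivative D (Suc j) x) (at x)) \<longrightarrow> M \<ge> 0 \<longrightarrow>
           (\<forall>x\<in>{a..a + l}. \<bar>D m x\<bar> \<ge> M) \<longrightarrow> (\<exists>a'. \<forall>x\<in>{a'..a' + l'}. \<bar>D 0 x\<bar> \<ge> c * M)"
  using assms
proof (induction m arbitrary: l)
  case 0
  then show ?case by (intro exI[of _ l] conjI exI[of _ 1]) auto
next
  case (Suc m)
  obtain l' c where l': "l' > 0" "c > 0" and
    IH: "\<And>(D :: nat \<Rightarrow> real \<Rightarrow> real) a M. (\<forall>j<m. \<forall>x. (D j has_real_derivative D (Suc j) x) (at x)) \<Longrightarrow> M \<ge> 0 \<Longrightarrow>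
           (\<forall>x\<in>{a..a + l / 4}. \<bar>D m x\<bar> \<ge> M) \<Longrightarrow> (\<exists>a'. \<forall>x\<in>{a'..a' + l'}. \<bar>D 0 x\<bar> \<ge> c * M)"
    using Suc.IH[of "l / 4"] Suc.prems by auto
  show ?case
  proof (rule exI[of _ l'], rule conjI[OF l'(1)], rule exI[of _ "c * l / 4"], intro conjI allI impI)
    fix D :: "nat \<Rightarrow> real \<Rightarrow> real" and a M :: real
    assume D: "\<forall>j<Suc m. \<forall>x. (D j has_real_derivative D (Suc j) x) (at x)" and M: "M \<ge> 0"
      and large: "\<forall>x\<in>{a..a + l}. \<bar>D (Suc m) x\<bar> \<ge> M"
    have der: "(D m has_real_derivative D (Suc m) x) (at x)" for x
      using D by blast
    obtain a' where "\<forall>x\<in>{a'..a' + l / 4}. \<bar>D m x\<bar> \<ge> M * l / 4"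
      using steep_imp_large_on_quarter[OF der M Suc.prems, of a] large by blast
    then obtain a'' where "\<forall>x\<in>{a''..a'' + l'}. \<bar>D 0 x\<bar> \<ge> c * (M * l / 4)"
      using IH[of D "M * l / 4" a'] D M Suc.prems by auto
    then show "\<exists>a'. \<forall>x\<in>{a'..a' + l'}. \<bar>D 0 x\<bar> \<ge> c * l / 4 * M"
      by (intro exI[of _ a'']) (simp add: mult_ac)
  qed (use l' Suc.prems in auto)
qed

text \<open>
  A derivative that oscillates little over unit intervals and is large at one point is large on a whole unit
  interval. The function is then large on an interval of fixed length, which its finite
  \<open>L\<^sub>2\<close>-norm limits.
\<close>

lemma square_integrable_derivative_bounded:
  fixes D :: "nat \<Rightarrow> real \<Rightarrow> real"
  assumes D: "\<And>j x. j < m \<Longrightarrow> (D j has_real_derivative D (Suc j) x) (at x)"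
    and int: "integrable lborel (\<lambda>x. (D 0 x)\<^sup>2)"
    and osc: "\<And>x y. \<bar>x - y\<bar> \<le> 1 \<Longrightarrow> \<bar>D m x - D m y\<bar> \<le> V"
  shows "\<exists>B. \<forall>x. \<bar>D m x\<bar> \<le> B"
proof -
  obtain l c where lc: "l > 0" "c > 0" and
    lrg: "\<And>(D :: nat \<Rightarrow> real \<Rightarrow> real) a M. (\<forall>j<m. \<forall>x. (D j has_real_derivative D (Suc j) x) (at x)) \<Longrightarrow> M \<ge> 0 \<Longrightarrow>
           (\<forall>x\<in>{a..a + 1}. \<bar>D m x\<bar> \<ge> M) \<Longrightarrow> (\<exists>a'. \<forall>x\<in>{a'..a' + l}. \<bar>D 0 x\<bar> \<ge> c * M)"
    using derivative_large_imp_function_large[of 1 m] by auto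
  define Q where "Q = (LINT x|lborel. (D 0 x)\<^sup>2)"
  have Q0: "Q \<ge> 0" unfolding Q_def by (rule Bochner_Integration.integral_nonneg) auto
  have V0: "V \<ge> 0" using osc[of 0 0] by simp
  have main: "\<bar>D m x\<bar> - V \<le> sqrt (Q / l) / c" for x
  proof (cases "\<bar>D m x\<bar> - V \<ge> 0")
    case True
    define N where "N = \<bar>D m x\<bar> - V"
    have "\<bar>D m y\<bar> \<ge> N" if "y \<in> {x..x + 1}" for y
    proof -
      have "\<bar>x - y\<bar> \<le> 1" using that by auto
      from osc[OF this] show ?thesis unfolding N_def by linarith
    qed
    then obtain a where "\<forall>y\<in>{a..a + l}. \<bar>D 0 y\<bar> \<ge> c * N"
      using lrg[of D N x] D True N_def by auto
    then have a: "\<And>y. y \<in> {a..a + l} \<Longrightarrow> \<bar>D 0 y\<bar> \<ge> c * N" by blast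
    have cN: "c * N \<ge> 0" using lc True N_def by auto
    have "(c * N)\<^sup>2 * l = (LINT y|lborel. (c * N)\<^sup>2 * indicator {a..a + l} y)"
      using lc by simp
    also have "\<dots> \<le> Q" unfolding Q_def
    proof (rule integral_mono)
      show "integrable lborel (\<lambda>y. (c * N)\<^sup>2 * indicator {a..a + l} y)" by (simp add: emeasure_lborel_Icc_eq)
      show "(c * N)\<^sup>2 * indicator {a..a + l} y \<le> (D 0 y)\<^sup>2" for y
        using a[of y] cN power_mono[of "c * N" "\<bar>D 0 y\<bar>" 2] by (auto simp: indicator_def)
    qed fact
    finally have "(c * N)\<^sup>2 \<le> Q / l" using lc by (simp add: field_simps)
    then have "c * N \<le> sqrt (Q / l)" using real_le_rsqrt by blast
    then show ?thesis using lc unfolding N_def[symmetric] by (simp add: field_simps)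
  next
    case False
    then show ?thesis using Q0 lc
      by (smt (verit) divide_nonneg_pos real_sqrt_ge_zero)
  qed
  show ?thesis
    by (rule exI[of _ "V + sqrt (Q / l) / c"]) (use main in \<open>auto simp: algebra_simps\<close>)
qed

lemma lipschitz_of_bounded_derivative:
  fixes F F' :: "real \<Rightarrow> real"
  assumes "\<And>x. (F has_real_derivative F' x) (at x)" and "\<And>x. \<bar>F' x\<bar> \<le> B"
  shows "\<bar>F x - F y\<bar> \<le> B * \<bar>x - y\<bar>"
  using field_differentiable_bound[of UNIV F F' B x y] assms
  by (auto intro: has_field_derivative_at_within)

text \<open>
  Downward induction: a bound for one derivative controls the oscillation of the derivative below it.
\<close>

lemma square_integrable_all_derivatives_bounded:
  fixes D :: "nat \<Rightarrow> real \<Rightarrow> real"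
  assumes D: "\<And>j x. j < k \<Longrightarrow> (D j has_real_derivative D (Suc j) x) (at x)"
    and int: "integrable lborel (\<lambda>x. (D 0 x)\<^sup>2)"
    and osc: "\<And>x y. \<bar>x - y\<bar> \<le> 1 \<Longrightarrow> \<bar>D k x - D k y\<bar> \<le> V"
  shows "\<exists>B. \<forall>j\<le>k. \<forall>x. \<bar>D j x\<bar> \<le> B"
proof -
  have each: "\<exists>B. \<forall>x. \<bar>D j x\<bar> \<le> B" if "j \<le> k" for j
    using that
  proof (induction j rule: inc_induct)
    case base
    show ?case by (rule square_integrable_derivative_bounded[OF D int osc])
  next
    case (step n)
    then obtain B where B: "\<And>x. \<bar>D (Suc n) x\<bar> \<le> B" by auto
    show ?case
    proof (rule square_integrable_derivative_bounded[OF D int])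
      show "\<bar>D n x - D n y\<bar> \<le> B" if "\<bar>x - y\<bar> \<le> 1" for x y
      proof -
        have "\<bar>D n x - D n y\<bar> \<le> B * \<bar>x - y\<bar>"
          using step D B by (intro lipschitz_of_bounded_derivative[where F' = "D (Suc n)"]) auto
        also have "\<dots> \<le> B * 1" using that B[of 0] by (intro mult_left_mono) auto
        finally show ?thesis by simp
      qed
    qed (use step in auto)
  qed
  then obtain B where B: "\<And>j x. j \<le> k \<Longrightarrow> \<bar>D j x\<bar> \<le> B j" by metis
  have "\<bar>D j x\<bar> \<le> (\<Sum>i\<le>k. \<bar>B i\<bar>)" if "j \<le> k" for j x
    using B[OF that, of x] member_le_sum[of j "{..k}" "\<lambda>i. \<bar>B i\<bar>"] that by auto
  then show ?thesis by blast
qed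

text \<open>
  The Lipschitz bound serves at distances up to \<open>1\<close>, the uniform bound beyond.
\<close>

lemma holder_of_bounded_lipschitz:
  fixes u :: "real \<Rightarrow> real"
  assumes b: "\<And>x. \<bar>u x\<bar> \<le> B" and lip: "\<And>x y. \<bar>u x - u y\<bar> \<le> B * \<bar>x - y\<bar>" and s: "0 < s" "s \<le> 1"
  shows "\<bar>u x - u y\<bar> \<le> 2 * B * \<bar>x - y\<bar> powr s"
proof (cases "\<bar>x - y\<bar> \<le> 1")
  case True
  have B: "B \<ge> 0" using b[of 0] by auto
  have "\<bar>x - y\<bar> \<le> \<bar>x - y\<bar> powr s"
    using True s powr_mono'[of s 1 "\<bar>x - y\<bar>"] by auto
  then have "B * \<bar>x - y\<bar> \<le> B * \<bar>x - y\<bar> powr s" using B by (rule mult_left_mono)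
  then show ?thesis using lip[of x y] mult_nonneg_nonneg[OF B, of "\<bar>x - y\<bar> powr s"] by auto
next
  case False
  have B: "B \<ge> 0" using b[of 0] by auto
  have "1 \<le> \<bar>x - y\<bar> powr s" using False s by (intro ge_one_powr_ge_zero) auto
  then have "2 * B * 1 \<le> 2 * B * \<bar>x - y\<bar> powr s" using B by (intro mult_left_mono) auto
  moreover have "\<bar>u x - u y\<bar> \<le> 2 * B" using b[of x] b[of y] by auto
  ultimately show ?thesis by auto
qed

section \<open>Truncation and rescaling in Hoelder classes\<close>

lemma DERIV_max_0_power:
  "((\<lambda>t::real. (max 0 t) ^ Suc (Suc m)) has_real_derivative (real (Suc (Suc m)) * (max 0 t) ^ Suc m)) (at t)"
proof (cases "t = 0")
  case True
  have "((\<lambda>t::real. max 0 t) \<longlongrightarrow> max 0 0) (at 0)" by (intro tendsto_intros)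
  then have "((\<lambda>t::real. (max 0 t) ^ Suc m) \<longlongrightarrow> 0 ^ Suc m) (at 0)"
    by (intro tendsto_power) simp
  then have lim: "((\<lambda>t::real. (max 0 t) ^ Suc m) \<longlongrightarrow> 0) (at 0)" by simp
  have "((\<lambda>h::real. ((max 0 (0 + h)) ^ Suc (Suc m) - (max 0 0) ^ Suc (Suc m)) / h) \<longlongrightarrow> 0) (at 0)"
    by (rule Lim_transform_eventually[OF lim])
       (auto simp: eventually_at_filter max_def field_simps)
  then show ?thesis using True by (simp add: DERIV_def)
next
  case False
  show ?thesis
  proof (cases "t > 0")
    case True
    have "((\<lambda>t::real. t ^ Suc (Suc m)) has_real_derivative (real (Suc (Suc m)) * (max 0 t) ^ Suc m)) (at t)"
      using True by (intro DERIV_pow[THEN DERIV_cong]) simp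
    then show ?thesis
      by (rule has_field_derivative_transform_within_open[where S = "{0<..}"]) (use True in auto)
  next
    case f: False
    with False have t: "t < 0" by simp
    have "((\<lambda>t::real. 0) has_real_derivative (real (Suc (Suc m)) * (max 0 t) ^ Suc m)) (at t)"
      using t by (auto intro!: derivative_eq_intros)
    then show ?thesis
      by (rule has_field_derivative_transform_within_open[where S = "{..<0}"]) (use t in auto)
  qed
qed

text \<open>
  The cutoff is the truncated power \<open>max 0 (1 - x\<^sup>2) ^ (k + 2)\<close>. Its \<open>j\<close>th derivative is a polynomial
  times the truncated power with exponent \<open>k + 2 - j\<close>, so \<open>k + 1\<close> derivatives exist on the whole line. One derivative more
  than the \<open>k\<close> of the Hoelder class is wanted, so that the \<open>k\<close>th one is Lipschitz.
\<close>

lemma exists_cutoff: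
  "\<exists>(E :: nat \<Rightarrow> real \<Rightarrow> real) B.
     (\<forall>j\<le>k. \<forall>x. (E j has_real_derivative E (Suc j) x) (at x)) \<and>
     (\<forall>j\<le>Suc k. \<forall>x. \<bar>E j x\<bar> \<le> B) \<and>
     E 0 0 = 1 \<and> (\<forall>x. \<bar>E 0 x\<bar> \<le> 1) \<and> (\<forall>x. \<bar>x\<bar> \<ge> 1 \<longrightarrow> E 0 x = 0)"
proof -
  define q :: "nat \<Rightarrow> real poly" where
    "q = rec_nat 1 (\<lambda>j p. pderiv p * [:1, 0, -1:] + of_nat (k + 2 - j) * p * [:0, -2:])"
  have q0: "q 0 = 1" and qS: "\<And>j. q (Suc j) = pderiv (q j) * [:1, 0, -1:] + of_nat (k + 2 - j) * q j * [:0, -2:]"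
    by (simp_all add: q_def)
  define w :: "real \<Rightarrow> real" where "w x = max 0 (1 - x\<^sup>2)" for x
  define E where "E j x = poly (q j) x * w x ^ (k + 2 - j)" for j x
  have D: "(E j has_real_derivative E (Suc j) x) (at x)" if "j \<le> k" for j x
  proof -
    define m where "m = k - j"
    have m: "k + 2 - j = Suc (Suc m)" "k + 2 - Suc j = Suc m" using that by (auto simp: m_def)
    have inner: "((\<lambda>x::real. 1 - x\<^sup>2) has_real_derivative (- 2 * x)) (at x)"
      by (auto intro!: derivative_eq_intros)
    have W: "((\<lambda>x. w x ^ Suc (Suc m)) has_real_derivative (real (Suc (Suc m)) * w x ^ Suc m * (- 2 * x))) (at x)"
      unfolding w_def by (rule DERIV_chain2[OF DERIV_max_0_power inner])
    have ww: "w x * w x ^ Suc m = (1 - x\<^sup>2) * w x ^ Suc m"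
      by (simp add: w_def max_def)
    have "((\<lambda>x. poly (q j) x * w x ^ Suc (Suc m)) has_real_derivative
       (poly (pderiv (q j)) x * w x ^ Suc (Suc m) + (real (Suc (Suc m)) * w x ^ Suc m * (- 2 * x)) * poly (q j) x)) (at x)"
      by (rule DERIV_mult'[OF poly_DERIV W, THEN DERIV_cong]) simp
    also have "poly (pderiv (q j)) x * w x ^ Suc (Suc m) = poly (pderiv (q j)) x * ((1 - x\<^sup>2) * w x ^ Suc m)"
      by (simp only: power_Suc[of "w x" "Suc m"] ww)
    also have "poly (pderiv (q j)) x * ((1 - x\<^sup>2) * w x ^ Suc m) + (real (Suc (Suc m)) * w x ^ Suc m * (- 2 * x)) * poly (q j) x = E (Suc j) x"
      unfolding E_def qS m by (simp add: algebra_simps power2_eq_square of_nat_poly)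
    finally show ?thesis
      using m by (simp only: E_def[abs_def])
  qed
  have zero: "E j x = 0" if "j \<le> Suc k" "\<bar>x\<bar> \<ge> 1" for j x
  proof -
    have "x\<^sup>2 \<ge> 1" using that by (simp add: abs_square_le_1 one_le_power abs_le_square_iff[of 1 x, simplified])
    then show ?thesis using that by (simp add: E_def w_def)
  qed
  have cont: "continuous_on {-1..1} (E j)" for j
    unfolding E_def w_def by (intro continuous_intros)
  have "\<exists>B. \<forall>x. \<bar>E j x\<bar> \<le> B" if j: "j \<le> Suc k" for j
  proof -
    have "bounded (E j ` {-1..1})" using cont compact_continuous_image compact_imp_bounded by blast
    then obtain B where B: "\<forall>x\<in>{-1..1}. \<bar>E j x\<bar> \<le> B" by (auto simp: bounded_iff)
    have "\<bar>E j x\<bar> \<le> B" for x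
      using bspec[OF B, of x] bspec[OF B, of 0] zero[OF j, of x] by (cases "\<bar>x\<bar> \<ge> 1") (auto simp: abs_if split: if_splits)
    then show ?thesis by blast
  qed
  then obtain B where B: "\<And>j x. j \<le> Suc k \<Longrightarrow> \<bar>E j x\<bar> \<le> B j" by metis
  have bd: "\<bar>E j x\<bar> \<le> (\<Sum>i\<le>Suc k. \<bar>B i\<bar>)" if "j \<le> Suc k" for j x
  proof -
    have "\<bar>B j\<bar> \<le> (\<Sum>i\<le>Suc k. \<bar>B i\<bar>)" by (rule member_le_sum) (use that in auto)
    then show ?thesis using B[OF that, of x] by linarith
  qed
  have one: "\<bar>E 0 x\<bar> \<le> 1" for x
    by (auto simp: E_def q0 w_def max_def intro!: power_le_one mult_le_one) 
  have "E 0 0 = 1" by (simp add: E_def q0 w_def)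
  moreover have "\<forall>x. \<bar>x\<bar> \<ge> 1 \<longrightarrow> E 0 x = 0" using zero[of 0] by blast
  ultimately show ?thesis using D bd one by blast
qed

text \<open>
  Successive derivatives are kept as a sequence of functions, the form in which
  \<^const>\<open>holder_class\<close> asks for them.
\<close>

lemma leibniz_chain:
  fixes F G :: "nat \<Rightarrow> real \<Rightarrow> real"
  assumes F: "\<And>j x. j < k \<Longrightarrow> (F j has_real_derivative F (Suc j) x) (at x)"
    and G: "\<And>j x. j < k \<Longrightarrow> (G j has_real_derivative G (Suc j) x) (at x)"
    and m: "m < k"
  shows "((\<lambda>x. \<Sum>j\<le>m. real (m choose j) * F j x * G (m - j) x) has_real_derivative
          (\<Sum>j\<le>Suc m. real (Suc m choose j) * F j x * G (Suc m - j) x)) (at x)"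
proof -
  have "((\<lambda>x. \<Sum>j\<le>m. real (m choose j) * F j x * G (m - j) x) has_real_derivative
          (\<Sum>j\<le>m. real (m choose j) * F (Suc j) x * G (m - j) x + real (m choose j) * F j x * G (Suc m - j) x)) (at x)"
  proof (rule DERIV_sum)
    fix j assume "j \<in> {..m}"
    then have j: "j < k" "m - j < k" "Suc m - j = Suc (m - j)" using m by auto
    show "((\<lambda>x. real (m choose j) * F j x * G (m - j) x) has_real_derivative
       (real (m choose j) * F (Suc j) x * G (m - j) x + real (m choose j) * F j x * G (Suc m - j) x)) (at x)"
      unfolding j(3)
      by (rule DERIV_mult[OF DERIV_cmult[OF F[OF j(1)]] G[OF j(2)], THEN DERIV_cong]) simp
  qed
  moreover have "(\<Sum>j\<le>m. real (m choose j) * F j x * G (Suc m - j) x)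
      = (\<Sum>j\<le>Suc m. real (m choose j) * F j x * G (Suc m - j) x)" by simp
  moreover have "\<dots> = F 0 x * G (Suc m) x + (\<Sum>j\<le>m. real (m choose Suc j) * F (Suc j) x * G (m - j) x)"
    by (subst sum.atMost_Suc_shift) simp
  moreover have "(\<Sum>j\<le>Suc m. real (Suc m choose j) * F j x * G (Suc m - j) x)
      = F 0 x * G (Suc m) x + (\<Sum>j\<le>m. real (m choose j) * F (Suc j) x * G (m - j) x + real (m choose Suc j) * F (Suc j) x * G (m - j) x)"
    by (subst sum.atMost_Suc_shift) (simp add: algebra_simps)
  ultimately show ?thesis by (simp only: sum.distrib ac_simps)
qed

lemma holder_product:
  fixes u v :: "real \<Rightarrow> real"
  assumes "\<bar>u x - u y\<bar> \<le> a * d" "\<bar>v x - v y\<bar> \<le> b * d" "\<bar>v x\<bar> \<le> B" "\<bar>u y\<bar> \<le> A" "d \<ge> 0"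
  shows "\<bar>u x * v x - u y * v y\<bar> \<le> (a * B + A * b) * d"
proof -
  have "u x * v x - u y * v y = (u x - u y) * v x + u y * (v x - v y)" by (simp add: algebra_simps)
  then have "\<bar>u x * v x - u y * v y\<bar> \<le> \<bar>u x - u y\<bar> * \<bar>v x\<bar> + \<bar>u y\<bar> * \<bar>v x - v y\<bar>"
    by (metis abs_mult abs_triangle_ineq)
  also have "\<dots> \<le> (a * d) * B + A * (b * d)"
    using assms by (intro add_mono mult_mono) auto
  finally show ?thesis by (simp add: algebra_simps)
qed

lemma continuous_of_holder:
  fixes g :: "real \<Rightarrow> real"
  assumes "\<And>x y. \<bar>g x - g y\<bar> \<le> B * \<bar>x - y\<bar> powr s" "s > 0"
  shows "continuous_on UNIV g"
proof (rule continuous_at_imp_continuous_on, rule ballI)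
  fix x :: real
  have "((\<lambda>y. \<bar>y - x\<bar>) \<longlongrightarrow> 0) (at x)" by (auto intro!: tendsto_eq_intros)
  then have "((\<lambda>y. \<bar>y - x\<bar> powr s) \<longlongrightarrow> 0 powr s) (at x)"
    using assms(2) by (intro tendsto_powr') auto
  then have l: "((\<lambda>y. B * \<bar>y - x\<bar> powr s) \<longlongrightarrow> 0) (at x)"
    using assms(2) by (auto intro!: tendsto_eq_intros)
  have "((\<lambda>y. g y - g x) \<longlongrightarrow> 0) (at x)"
    by (rule Lim_null_comparison[OF _ l]) (simp add: assms(1))
  then show "isCont g x" unfolding isCont_def by (simp add: LIM_zero_iff)
qed

text \<open>
  The \<open>k\<close>th derivative gains a factor \<open>1 / b ^ k\<close>, and increments of its argument are multiplied by
  \<open>1 / b\<close>. Together this divides the Hoelder constant by \<^term>\<open>b powr \<beta>\<close>.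
\<close>

lemma holder_class_rescale:
  assumes g: "g \<in> holder_class \<beta> H UNIV" and a: "a \<ge> 0" and b: "b > 0"
    and aH: "a * H \<le> L * b powr \<beta>"
  shows "(\<lambda>x. a * g ((x - t) / b)) \<in> holder_class \<beta> L S"
proof -
  obtain k D where k: "real k < \<beta>" "\<beta> \<le> real k + 1" and D0: "\<forall>x. D 0 x = g x"
    and D: "\<forall>j<k. \<forall>x. (D j has_real_derivative D (Suc j) x) (at x)"
    and Dk: "\<forall>x y. \<bar>D k x - D k y\<bar> \<le> H * \<bar>x - y\<bar> powr (\<beta> - real k)"
    using g unfolding holder_class_def by auto
  define D' where "D' j x = a / b ^ j * D j ((x - t) / b)" for j x
  have der: "(D' j has_real_derivative D' (Suc j) x) (at x within S)" if "j < k" for j x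
  proof -
    have inner: "((\<lambda>x. (x - t) / b) has_real_derivative 1 / b) (at x within S)"
      using b by (auto intro!: derivative_eq_intros)
    have "(D j has_real_derivative D (Suc j) ((x - t) / b)) (at ((x - t) / b))" using D that by blast
    from DERIV_cmult[OF DERIV_chain2[OF this inner], of "a / b ^ j"] show ?thesis
      unfolding D'_def using b by (simp add: field_simps)
  qed
  have "\<bar>D' k x - D' k y\<bar> \<le> L * \<bar>x - y\<bar> powr (\<beta> - real k)" for x y
  proof -
    have "\<bar>D' k x - D' k y\<bar> = a / b ^ k * \<bar>D k ((x - t) / b) - D k ((y - t) / b)\<bar>"
    proof -
      have "D' k x - D' k y = a / b ^ k * (D k ((x - t) / b) - D k ((y - t) / b))"
        unfolding D'_def by (rule right_diff_distrib[symmetric])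
      then show ?thesis using a b by (simp only: abs_mult) simp
    qed
    also have "\<dots> \<le> a / b ^ k * (H * \<bar>(x - t) / b - (y - t) / b\<bar> powr (\<beta> - real k))"
      using Dk a b by (intro mult_left_mono) auto
    also have "\<bar>(x - t) / b - (y - t) / b\<bar> = \<bar>x - y\<bar> / b"
      using b by (simp add: diff_divide_distrib[symmetric])
    also have "a / b ^ k * (H * (\<bar>x - y\<bar> / b) powr (\<beta> - real k))
        = (a * H) / b powr \<beta> * \<bar>x - y\<bar> powr (\<beta> - real k)"
      using b by (simp add: powr_divide powr_diff powr_realpow field_simps)
    also have "\<dots> \<le> L * \<bar>x - y\<bar> powr (\<beta> - real k)"
      using aH b by (intro mult_right_mono) (auto simp: field_simps)
    finally show ?thesis .
  qed
  then show ?thesis unfolding holder_class_def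
    by (intro CollectI exI[of _ k] conjI exI[of _ D']) (use k der D0 in \<open>auto simp: D'_def\<close>)
qed

text \<open>
  Multiplying \<^term>\<open>\<gamma>\<close> by a cutoff stretched to the scale \<^term>\<open>K\<close> decreases the \<open>L\<^sub>2\<close>-norm, keeps
  the value at \<open>0\<close> and increases the Hoelder constant by a term of order \<^term>\<open>K powr - s\<close> only: in the Leibniz
  formula for the highest derivative, all terms but the leading one carry a derivative of the stretched cutoff and
  hence a factor \<open>1 / K\<close>, and in the leading one the cutoff is at most \<open>1\<close>, with Hoelder
  constant of order \<^term>\<open>K powr - s\<close>. This uses that all derivatives of \<^term>\<open>\<gamma>\<close> are bounded.
  The Hoelder bound for the function itself controls its oscillation between neighbouring design points.
\<close>

lemma compactly_supported_competitor:
  assumes "\<beta> > 0" and \<gamma>: "\<gamma> \<in> holder_class \<beta> 1 UNIV"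
    and int: "integrable lborel (\<lambda>x. (\<gamma> x)\<^sup>2)"
  shows "\<exists>C B s. C \<ge> 0 \<and> B > 0 \<and> 0 < s \<and> s \<le> 1 \<and> (\<forall>K\<ge>1. \<exists>g. g \<in> holder_class \<beta> (1 + C * K powr - s) UNIV \<and>
    g 0 = \<gamma> 0 \<and> (\<forall>x. \<bar>g x\<bar> \<le> \<bar>\<gamma> x\<bar>) \<and> (\<forall>x. \<bar>g x\<bar> \<le> B) \<and> (\<forall>x. \<bar>x\<bar> \<ge> K \<longrightarrow> g x = 0) \<and>
    (\<forall>x y. \<bar>g x - g y\<bar> \<le> B * \<bar>x - y\<bar> powr s))"
proof -
  obtain k D where k: "real k < \<beta>" "\<beta> \<le> real k + 1" and D0': "\<forall>x. D 0 x = \<gamma> x"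
    and D': "\<forall>j<k. \<forall>x. (D j has_real_derivative D (Suc j) x) (at x)"
    and Dk': "\<forall>x y. \<bar>D k x - D k y\<bar> \<le> \<bar>x - y\<bar> powr (\<beta> - real k)"
    using \<gamma> unfolding holder_class_def by auto
  have D0: "\<And>x. D 0 x = \<gamma> x"
    and D: "\<And>j x. j < k \<Longrightarrow> (D j has_real_derivative D (Suc j) x) (at x)"
    and Dk: "\<And>x y. \<bar>D k x - D k y\<bar> \<le> \<bar>x - y\<bar> powr (\<beta> - real k)"
    using D0' D' Dk' by auto
  define s where "s = \<beta> - real k"
  have s: "0 < s" "s \<le> 1" using k by (auto simp: s_def)
  have "\<exists>B. \<forall>j\<le>k. \<forall>x. \<bar>D j x\<bar> \<le> B"
  proof (rule square_integrable_all_derivatives_bounded)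
    show "(D j has_real_derivative D (Suc j) x) (at x)" if "j < k" for j x using D[OF that] .
    show "integrable lborel (\<lambda>x. (D 0 x)\<^sup>2)" using int D0 by simp
    show "\<bar>D k x - D k y\<bar> \<le> 1" if "\<bar>x - y\<bar> \<le> 1" for x y
      using Dk[of x y] powr_le1[of "\<beta> - real k" "\<bar>x - y\<bar>"] that k by auto
  qed
  then obtain A where A: "\<And>j x. j \<le> k \<Longrightarrow> \<bar>D j x\<bar> \<le> A" by blast
  obtain E B where E: "\<And>j x. j \<le> k \<Longrightarrow> (E j has_real_derivative E (Suc j) x) (at x)"
    and EB: "\<And>j x. j \<le> Suc k \<Longrightarrow> \<bar>E j x\<bar> \<le> B"
    and E0: "E 0 0 = 1" "\<And>x. \<bar>E 0 x\<bar> \<le> 1" "\<And>x. \<bar>x\<bar> \<ge> 1 \<Longrightarrow> E 0 x = 0"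
    using exists_cutoff[of k] by blast
  have A0: "A \<ge> 0" using A[of 0 0] by auto
  have B0: "B \<ge> 0" using EB[of 0 0] by auto
  have E_holder: "\<bar>E j x - E j y\<bar> \<le> 2 * B * \<bar>x - y\<bar> powr s" if "j \<le> k" for j x y
    by (rule holder_of_bounded_lipschitz[OF _ _ s])
       (use that EB in \<open>auto intro!: lipschitz_of_bounded_derivative[where F' = "E (Suc j)"] E\<close>)
  have D_holder: "\<bar>D j x - D j y\<bar> \<le> 2 * A * \<bar>x - y\<bar> powr s" if "j < k" for j x y
    by (rule holder_of_bounded_lipschitz[OF _ _ s])
       (use that A in \<open>auto intro!: lipschitz_of_bounded_derivative[where F' = "D (Suc j)"] D\<close>)
  define C where "C = (\<Sum>j\<le>k. real (k choose j) * (4 * A * B))"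
  have C0: "C \<ge> 0" unfolding C_def using A0 B0 by (intro sum_nonneg) auto
  define B' where "B' = 2 * A + 1 + 2 * A * B"
  have B': "B' > 0" "A \<le> B'" using A0 mult_nonneg_nonneg[OF A0 B0] by (auto simp: B'_def)
  have main: "\<exists>g. g \<in> holder_class \<beta> (1 + C * K powr - s) UNIV \<and>
    g 0 = \<gamma> 0 \<and> (\<forall>x. \<bar>g x\<bar> \<le> \<bar>\<gamma> x\<bar>) \<and> (\<forall>x. \<bar>g x\<bar> \<le> B') \<and> (\<forall>x. \<bar>x\<bar> \<ge> K \<longrightarrow> g x = 0) \<and>
    (\<forall>x y. \<bar>g x - g y\<bar> \<le> B' * \<bar>x - y\<bar> powr s)" if K: "K \<ge> 1" for K
  proof -
    define X where "X j x = E j (x / K) / K ^ j" for j x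
    have Xder: "(X j has_real_derivative X (Suc j) x) (at x)" if "j \<le> k" for j x
    proof -
      have "((\<lambda>x. x / K) has_real_derivative 1 / K) (at x)"
        using K by (auto intro!: derivative_eq_intros)
      from DERIV_chain2[OF E[OF that] this]
      have "((\<lambda>x. E j (x / K)) has_real_derivative E (Suc j) (x / K) * (1 / K)) (at x)" .
      from DERIV_cdivide[OF this, of "K ^ j"] show ?thesis
        unfolding X_def by (simp add: field_simps)
    qed
    have X_holder: "\<bar>X j x - X j y\<bar> \<le> (2 * B * K powr - s) * \<bar>x - y\<bar> powr s" if "j \<le> k" for j x y
    proof -
      have "\<bar>X j x - X j y\<bar> = \<bar>E j (x / K) - E j (y / K)\<bar> / K ^ j"
        using K by (simp add: X_def diff_divide_distrib[symmetric])
      also have "\<dots> \<le> \<bar>E j (x / K) - E j (y / K)\<bar> / 1"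
        using K by (intro divide_left_mono) auto
      also have "\<dots> \<le> 2 * B * \<bar>x / K - y / K\<bar> powr s" using E_holder[OF that] by simp
      also have "\<bar>x / K - y / K\<bar> powr s = K powr - s * \<bar>x - y\<bar> powr s"
        using K by (simp add: diff_divide_distrib[symmetric] powr_divide powr_minus divide_simps)
      finally show ?thesis by (simp add: mult_ac)
    qed
    have X_bound: "\<bar>X j x\<bar> \<le> B * K powr - s" if "0 < j" "j \<le> k" for j x
    proof -
      have "K powr s \<le> K powr real j" using K s that by (intro powr_mono) auto
      then have "K powr s \<le> K ^ j" using K by (simp add: powr_realpow)
      then have "1 / K ^ j \<le> K powr - s" using K by (simp add: powr_minus divide_simps)
      have "\<bar>X j x\<bar> = \<bar>E j (x / K)\<bar> * (1 / K ^ j)" using K by (simp add: X_def)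
      also have "\<dots> \<le> B * K powr - s"
        by (rule mult_mono) (use EB[of j] that B0 K \<open>1 / K ^ j \<le> K powr - s\<close> in auto)
      finally show ?thesis .
    qed
    define g where "g x = D 0 x * X 0 x" for x
    define P where "P m x = (\<Sum>j\<le>m. real (m choose j) * D j x * X (m - j) x)" for m x
    have P: "(P m has_real_derivative P (Suc m) x) (at x)" if "m < k" for m x
      unfolding P_def[abs_def] using that D Xder by (intro leibniz_chain[where k = k]) auto
    have term_bound: "\<bar>real (k choose j) * D j x * X (k - j) x - real (k choose j) * D j y * X (k - j) y\<bar>
       \<le> (if j = k then 1 else 0) * \<bar>x - y\<bar> powr s + real (k choose j) * (4 * A * B) * (K powr - s * \<bar>x - y\<bar> powr s)" 
       if j: "j \<le> k" for j x y
    proof (cases "j = k")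
      case True
      have "\<bar>D k x * X 0 x - D k y * X 0 y\<bar> \<le> (1 * 1 + A * (2 * B * K powr - s)) * \<bar>x - y\<bar> powr s"
        by (rule holder_product) (use Dk[of x y] X_holder[of 0 x y] E0 A[of k y] in \<open>auto simp: s_def X_def\<close>)
      also have "\<dots> \<le> 1 * \<bar>x - y\<bar> powr s + 4 * A * B * (K powr - s * \<bar>x - y\<bar> powr s)"
        using A0 B0 by (simp add: algebra_simps mult_right_mono)
      finally show ?thesis using True by simp
    next
      case False
      have "\<bar>D j x * X (k - j) x - D j y * X (k - j) y\<bar>
          \<le> (2 * A * (B * K powr - s) + A * (2 * B * K powr - s)) * \<bar>x - y\<bar> powr s"
        by (rule holder_product) (use j False D_holder[of j x y] X_holder[of "k - j" x y] X_bound[of "k - j" x] A[of j y] in auto)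
      then have *: "\<bar>D j x * X (k - j) x - D j y * X (k - j) y\<bar> \<le> (4 * A * B) * (K powr - s * \<bar>x - y\<bar> powr s)"
        by (simp add: algebra_simps)
      have "\<bar>real (k choose j) * D j x * X (k - j) x - real (k choose j) * D j y * X (k - j) y\<bar>
          = real (k choose j) * \<bar>D j x * X (k - j) x - D j y * X (k - j) y\<bar>"
        by (simp add: abs_mult right_diff_distrib[symmetric] mult.assoc)
      also have "\<dots> \<le> real (k choose j) * ((4 * A * B) * (K powr - s * \<bar>x - y\<bar> powr s))"
        using * by (intro mult_left_mono) auto
      finally show ?thesis using False by (simp add: mult.assoc)
    qed
    have Pk: "\<bar>P k x - P k y\<bar> \<le> (1 + C * K powr - s) * \<bar>x - y\<bar> powr (\<beta> - real k)" for x y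
    proof -
      have "\<bar>P k x - P k y\<bar> \<le> (\<Sum>j\<le>k. \<bar>real (k choose j) * D j x * X (k - j) x - real (k choose j) * D j y * X (k - j) y\<bar>)"
        unfolding P_def sum_subtractf[symmetric] by (rule sum_abs)
      also have "\<dots> \<le> (\<Sum>j\<le>k. (if j = k then 1 else 0) * \<bar>x - y\<bar> powr s + real (k choose j) * (4 * A * B) * (K powr - s * \<bar>x - y\<bar> powr s))"
        by (intro sum_mono term_bound) auto
      also have "\<dots> = (\<Sum>j\<le>k. (if j = k then 1 else 0)) * \<bar>x - y\<bar> powr s + C * (K powr - s * \<bar>x - y\<bar> powr s)"
        unfolding sum.distrib C_def sum_distrib_right ..
      also have "\<dots> = (1 + C * K powr - s) * \<bar>x - y\<bar> powr (\<beta> - real k)"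
        by (simp add: algebra_simps s_def)
      finally show ?thesis .
    qed
    have "g \<in> holder_class \<beta> (1 + C * K powr - s) UNIV"
      unfolding holder_class_def
      by (intro CollectI exI[of _ k] conjI exI[of _ P]) (use k P Pk in \<open>auto simp: P_def g_def\<close>)
    moreover have "g 0 = \<gamma> 0" by (simp add: g_def X_def E0 D0)
    moreover have le: "\<bar>g x\<bar> \<le> \<bar>\<gamma> x\<bar>" for x
      using mult_left_mono[OF E0(2)[of "x / K"], of "\<bar>\<gamma> x\<bar>"] by (simp add: g_def X_def D0 abs_mult)
    moreover have "\<bar>g x\<bar> \<le> B'" for x
      using le[of x] A[of 0 x] B' by (simp add: D0)
    moreover have "g x = 0" if "\<bar>x\<bar> \<ge> K" for x
      using E0(3)[of "x / K"] that K by (simp add: g_def X_def)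
    moreover have "\<bar>g x - g y\<bar> \<le> B' * \<bar>x - y\<bar> powr s" for x y
    proof -
      have D0h: "\<bar>D 0 x - D 0 y\<bar> \<le> (2 * A + 1) * \<bar>x - y\<bar> powr s"
      proof (cases "k = 0")
        case True
        then have "\<bar>D 0 x - D 0 y\<bar> \<le> 1 * \<bar>x - y\<bar> powr s" using Dk[of x y] by (simp add: s_def)
        also have "\<dots> \<le> (2 * A + 1) * \<bar>x - y\<bar> powr s" using A0 by (intro mult_right_mono) auto
        finally show ?thesis .
      next
        case False
        then have "\<bar>D 0 x - D 0 y\<bar> \<le> 2 * A * \<bar>x - y\<bar> powr s" by (intro D_holder) auto
        also have "\<dots> \<le> (2 * A + 1) * \<bar>x - y\<bar> powr s" by (intro mult_right_mono) auto
        finally show ?thesis .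
      qed
      have "K powr - s \<le> 1" using K s by (simp add: powr_minus divide_simps ge_one_powr_ge_zero)
      then have "2 * B * K powr - s \<le> 2 * B * 1" using B0 by (intro mult_left_mono) auto
      then have "2 * B * K powr - s * \<bar>x - y\<bar> powr s \<le> 2 * B * \<bar>x - y\<bar> powr s"
        by (intro mult_right_mono) auto
      then have "\<bar>X 0 x - X 0 y\<bar> \<le> 2 * B * \<bar>x - y\<bar> powr s" using X_holder[of 0 x y] by auto
      then have "\<bar>g x - g y\<bar> \<le> ((2 * A + 1) * 1 + A * (2 * B)) * \<bar>x - y\<bar> powr s"
        unfolding g_def by (intro holder_product D0h) (use E0 A[of 0 y] in \<open>auto simp: X_def\<close>)
      then show ?thesis by (simp add: B'_def algebra_simps)
    qed
    ultimately show ?thesis by blast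
  qed
  show ?thesis using C0 B' s main by blast
qed

section \<open>Sums over the design points\<close>

lemma design_cdf_eq_integral:
  assumes hpos: "\<And>x. x \<in> {0..1} \<Longrightarrow> h x > (0::real)" and hc: "continuous_on {0..1} h"
    and x: "x \<in> {0..1}"
  shows "design_cdf h x = integral {0..x} h"
proof -
  have meas: "(\<lambda>x. ennreal (h x) * indicator {0..1} x) \<in> borel_measurable borel"
  proof -
    have "(\<lambda>x. indicator {0..1} x *\<^sub>R h x) \<in> borel_measurable borel"
      by (rule borel_measurable_continuous_on_indicator) (use hc in auto)
    then have "(\<lambda>x. ennreal (indicator {0..1} x *\<^sub>R h x)) \<in> borel_measurable borel" by simp
    moreover have "(\<lambda>x. ennreal (indicator {0..1} x *\<^sub>R h x)) = (\<lambda>x. ennreal (h x) * indicator {0..1} x)"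
      by (auto simp: indicator_def)
    ultimately show ?thesis by simp
  qed
  have hc': "continuous_on {0..x} h" by (rule continuous_on_subset[OF hc]) (use x in auto)
  then have hi: "(h has_integral integral {0..x} h) {0..x}"
    by (intro integrable_integral integrable_continuous_real)
  have nonneg: "0 \<le> h y" if "y \<in> {0..x}" for y
  proof -
    have "y \<in> {0..1}" using that x by auto
    from hpos[OF this] show ?thesis by simp
  qed
  have "emeasure (density lborel (\<lambda>x. ennreal (h x) * indicator {0..1} x)) {..x}
     = (\<integral>\<^sup>+ y. ennreal (h y) * indicator {0..1} y * indicator {..x} y \<partial>lborel)"
    by (rule emeasure_density) (use meas in auto)
  also have "\<dots> = (\<integral>\<^sup>+ y. ennreal (h y) * indicator {0..x} y \<partial>lborel)"
    using x by (intro nn_integral_cong) (auto simp: indicator_def)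
  also have "\<dots> = ennreal (integral {0..x} h)"
    by (rule nn_integral_has_integral_lebesgue'[OF nonneg hi])
  finally show ?thesis
    using integral_nonneg[OF has_integral_integrable[OF hi] nonneg]
    by (simp add: design_cdf_def cdf_def2 measure_def)
qed

lemma design_cdf_has_derivative:
  assumes hpos: "\<And>x. x \<in> {0..1} \<Longrightarrow> h x > (0::real)" and hc: "continuous_on {0..1} h"
    and x: "x \<in> {0..1}"
  shows "(design_cdf h has_real_derivative h x) (at x within {0..1})"
proof -
  have d: "((\<lambda>x. integral {0..x} h) has_real_derivative h x) (at x within {0..1})"
    using hc x by (rule integral_has_real_derivative)
  show ?thesis
    by (rule has_field_derivative_transform_within[OF d zero_less_one x])
       (use design_cdf_eq_integral[OF hpos hc] in auto)
qed

lemma design_cdf_mean_value: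
  assumes hpos: "\<And>x. x \<in> {0..1} \<Longrightarrow> h x > (0::real)" and hc: "continuous_on {0..1} h"
    and ab: "0 \<le> a" "a < b" "b \<le> 1"
  shows "\<exists>\<xi>. a < \<xi> \<and> \<xi> < b \<and> design_cdf h b - design_cdf h a = (b - a) * h \<xi>"
proof -
  have "\<exists>\<xi>>a. \<xi> < b \<and> design_cdf h b - design_cdf h a = (\<lambda>x. (*) (h x)) \<xi> (b - a)"
  proof (rule mvt[OF ab(2)])
    show "continuous_on {a..b} (design_cdf h)"
      by (rule DERIV_continuous_on[where D = h], rule DERIV_subset[OF design_cdf_has_derivative[OF hpos hc]])
         (use ab in auto)
    show "(design_cdf h has_derivative (*) (h x)) (at x)" if "a < x" "x < b" for x
    proof -
      have "at x within {0..1} = at x"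
        by (rule at_within_interior) (use that ab in \<open>auto simp: interior_atLeastAtMost_real\<close>)
      then show ?thesis
        using design_cdf_has_derivative[OF hpos hc, of x] that ab by (auto simp: has_field_derivative_def)
    qed
  qed blast
  then show ?thesis by (metis mult.commute)
qed

lemma design_cdf_strict_mono:
  assumes hpos: "\<And>x. x \<in> {0..1} \<Longrightarrow> h x > (0::real)" and hc: "continuous_on {0..1} h"
  shows "strict_mono_on {0..1} (design_cdf h)"
proof (rule strict_mono_onI)
  fix a b :: real assume ab: "a \<in> {0..1}" "b \<in> {0..1}" "a < b"
  then obtain \<xi> where "a < \<xi>" "\<xi> < b" "design_cdf h b - design_cdf h a = (b - a) * h \<xi>"
    using design_cdf_mean_value[OF hpos hc, of a b] by auto
  moreover from this have "h \<xi> > 0" using hpos[of \<xi>] ab by auto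
  ultimately show "design_cdf h a < design_cdf h b" using ab
    by (smt (verit) mult_pos_pos)
qed

lemma design_point_props:
  assumes hpos: "\<And>x. x \<in> {0..1} \<Longrightarrow> h x > (0::real)" and hc: "continuous_on {0..1} h"
    and h1: "(LINT x:{0..1}|lborel. h x) = 1" and n: "n \<ge> 1" "i \<le> n"
  shows "design_point h n i \<in> {0..1}" "design_cdf h (design_point h n i) = real i / real n"
proof -
  have H0: "design_cdf h 0 = 0" using design_cdf_eq_integral[OF hpos hc, of 0] by simp
  have "design_cdf h 1 = integral {0..1} h" using design_cdf_eq_integral[OF hpos hc, of 1] by simp
  also have "\<dots> = 1"
    using set_borel_integral_eq_integral(2)[OF borel_integrable_atLeastAtMost'[OF hc]] h1 by simp
  finally have H1: "design_cdf h 1 = 1" .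
  have "continuous_on {0..1} (design_cdf h)"
    by (rule DERIV_continuous_on[OF design_cdf_has_derivative[OF hpos hc]])
  then have "\<exists>x\<ge>0. x \<le> 1 \<and> design_cdf h x = real i / real n"
    using n by (intro IVT') (auto simp: H0 H1)
  then have mem: "real i / real n \<in> design_cdf h ` {0..1}" by force
  have inj: "inj_on (design_cdf h) {0..1}"
    by (rule strict_mono_on_imp_inj_on[OF design_cdf_strict_mono[OF hpos hc]])
  show "design_point h n i \<in> {0..1}"
    unfolding design_point_def by (rule the_inv_into_into[OF inj mem order_refl])
  show "design_cdf h (design_point h n i) = real i / real n"
    unfolding design_point_def by (rule f_the_inv_into_f[OF inj mem])
qed

lemma sum_odd_le_sum:
  fixes g :: "nat \<Rightarrow> real"
  assumes "\<And>j. g j \<ge> 0"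
  shows "(\<Sum>i<n. g (Suc (2 * i))) \<le> (\<Sum>j<2 * n. g j)"
proof (induction n)
  case (Suc n)
  have "{..<2 * Suc n} = {..<Suc (Suc (2 * n))}" by simp
  then show ?case using Suc assms[of "2 * n"] by simp
qed simp

text \<open>
  By the mean value theorem the cell between consecutive design points has length
  \<open>1 / (n * h \<xi>)\<close> for some \<open>\<xi>\<close> in the cell. Hence the \<open>i\<close>th summand is \<open>n\<close> times the integral over the \<open>i\<close>th cell of a
  constant that is at most \<^term>\<open>Q\<close> there, up to replacing \<open>h\<close> at \<open>\<xi>\<close> by \<open>h\<close> at the design point. These replacements are paid for
  by the total variation of \<open>h\<close>, because the points \<open>\<xi>\<close> interlace with the design points. The majorant \<^term>\<open>Q\<close>
  absorbs the oscillation of \<^term>\<open>F\<close> within a cell.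
\<close>

lemma design_sum_le_integral:
  assumes hpos: "\<And>x. x \<in> {0..1} \<Longrightarrow> h x > (0::real)" and hc: "continuous_on {0..1} h"
    and h1: "(LINT x:{0..1}|lborel. h x) = 1" and n: "n \<ge> 1"
    and V: "\<And>m t. (\<forall>i\<le>m. t i \<in> {0..1}) \<Longrightarrow> mono_on {..m::nat} t \<Longrightarrow> (\<Sum>i<m. \<bar>h (t (Suc i)) - h (t i)\<bar>) \<le> V"
    and c: "c > 0" "\<And>x. x \<in> {0..1} \<Longrightarrow> h x \<ge> c"
    and F: "\<And>x. 0 \<le> F x" "\<And>x. F x \<le> A"
    and Q: "integrable lborel Q" "\<And>x. 0 \<le> Q x"
    and FQ: "\<And>x y. \<bar>x - y\<bar> \<le> 1 / (real n * c) \<Longrightarrow> F y \<le> Q x"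
  shows "(\<Sum>i\<in>{1..n}. F (design_point h n i) / h (design_point h n i))
     \<le> real n * (LINT x|lborel. Q x) + A * V / c\<^sup>2"
proof -
  define X where "X i = design_point h n i" for i
  have npos: "real n > 0" using n by simp
  have X01: "X i \<in> {0..1}" and HX: "design_cdf h (X i) = real i / real n" if "i \<le> n" for i
    using design_point_props[OF hpos hc h1 n that] by (auto simp: X_def)
  have Xless: "X i < X j" if "i < j" "j \<le> n" for i j
  proof -
    have "design_cdf h (X i) < design_cdf h (X j)" using that npos by (simp add: HX divide_strict_right_mono)
    then show ?thesis
      using strict_mono_on_less[OF design_cdf_strict_mono[OF hpos hc]] X01 that by auto
  qed
  have Xle: "X i \<le> X j" if "i \<le> j" "j \<le> n" for i j
    using Xless[of i j] that by (cases "i = j") auto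
  have "\<exists>\<xi>. X i < \<xi> \<and> \<xi> < X (Suc i) \<and> 1 / real n = (X (Suc i) - X i) * h \<xi>" if "i < n" for i
  proof -
    have "design_cdf h (X (Suc i)) - design_cdf h (X i) = 1 / real n"
      using that by (simp add: HX diff_divide_distrib[symmetric])
    then show ?thesis
      using design_cdf_mean_value[OF hpos hc, of "X i" "X (Suc i)"] Xless[of i "Suc i"] X01[of i] X01[of "Suc i"] that by auto
  qed
  then obtain \<xi> where \<xi>: "\<And>i. i < n \<Longrightarrow> X i < \<xi> i" "\<And>i. i < n \<Longrightarrow> \<xi> i < X (Suc i)"
    and cell: "\<And>i. i < n \<Longrightarrow> 1 / real n = (X (Suc i) - X i) * h (\<xi> i)" by metis
  have \<xi>01: "\<xi> i \<in> {0..1}" if "i < n" for i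
    using \<xi>[OF that] X01[of i] X01[of "Suc i"] that by auto
  have width: "X (Suc i) - X i \<le> 1 / (real n * c)" if "i < n" for i
  proof -
    have "(X (Suc i) - X i) * c \<le> (X (Suc i) - X i) * h (\<xi> i)"
      using c(2)[OF \<xi>01[OF that]] Xle[of i "Suc i"] that by (intro mult_left_mono) auto
    also have "\<dots> = 1 / real n" using cell[OF that] by simp
    finally show ?thesis using c npos by (simp add: field_simps)
  qed
  (* The design points and the mean value points in one increasing sequence. Only its odd steps, from a
     mean value point to the next design point, are needed. *)
  define t where "t j = (if even j then X (j div 2) else \<xi> (j div 2))" for j
  have tstep: "t j \<le> t (Suc j)" if "j < 2 * n" for j
  proof (cases "even j")
    case True
    then have "j div 2 < n" "Suc j div 2 = j div 2" using that by auto
    then show ?thesis using True \<xi>(1)[of "j div 2"] by (simp add: t_def)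
  next
    case False
    then have "j div 2 < n" "Suc j div 2 = Suc (j div 2)" using that by auto
    then show ?thesis using False \<xi>(2)[of "j div 2"] by (simp add: t_def)
  qed
  have "mono_on {..2 * n} t"
  proof (rule mono_onI)
    fix i j assume "i \<in> {..2 * n}" "j \<in> {..2 * n}" "i \<le> j"
    from \<open>i \<le> j\<close> \<open>j \<in> {..2 * n}\<close> show "t i \<le> t j"
    proof (induction rule: dec_induct)
      case (step j)
      then have "t i \<le> t j" "t j \<le> t (Suc j)" using tstep[of j] by auto
      then show ?case by linarith
    qed simp
  qed
  moreover have "\<forall>i\<le>2 * n. t i \<in> {0..1}"
  proof (intro allI impI)
    fix j assume "j \<le> 2 * n"
    then have "j div 2 \<le> n" "odd j \<Longrightarrow> j div 2 < n" by presburger+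
    then show "t j \<in> {0..1}" using X01[of "j div 2"] \<xi>01[of "j div 2"] by (cases "even j") (auto simp: t_def)
  qed
  ultimately have "(\<Sum>i<2 * n. \<bar>h (t (Suc i)) - h (t i)\<bar>) \<le> V" by (intro V)
  moreover have "(\<Sum>i<n. \<bar>h (t (Suc (Suc (2 * i)))) - h (t (Suc (2 * i)))\<bar>) \<le> (\<Sum>i<2 * n. \<bar>h (t (Suc i)) - h (t i)\<bar>)"
    by (rule sum_odd_le_sum) auto
  ultimately have TV: "(\<Sum>i<n. \<bar>h (X (Suc i)) - h (\<xi> i)\<bar>) \<le> V"
    by (simp add: t_def)
  have A0: "A \<ge> 0" using F[of 0] by linarith
  have each: "F (X (Suc i)) / h (X (Suc i)) \<le> real n * (LINT x|lborel. F (X (Suc i)) * indicator {X i<..X (Suc i)} x)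
       + A / c\<^sup>2 * \<bar>h (X (Suc i)) - h (\<xi> i)\<bar>" if i: "i < n" for i
  proof -
    define u v where "u = h (X (Suc i))" and "v = h (\<xi> i)"
    have uv: "u \<ge> c" "v \<ge> c" using c(2) X01[of "Suc i"] \<xi>01[OF i] i by (auto simp: u_def v_def)
    have "1 / u - 1 / v = (v - u) / (u * v)" using uv c by (simp add: field_simps)
    also have "\<dots> \<le> \<bar>u - v\<bar> / (u * v)" using uv c by (intro divide_right_mono) auto
    also have "\<dots> \<le> \<bar>u - v\<bar> / c\<^sup>2" using uv c
      by (intro divide_left_mono) (auto simp: power2_eq_square intro!: mult_mono)
    finally have d: "1 / u \<le> 1 / v + \<bar>u - v\<bar> / c\<^sup>2" by simp
    have inv: "1 / v = real n * (X (Suc i) - X i)"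
      using cell[OF i] uv c npos unfolding v_def by (simp add: field_simps)
    have "F (X (Suc i)) / u \<le> F (X (Suc i)) * (1 / v) + F (X (Suc i)) * (\<bar>u - v\<bar> / c\<^sup>2)"
      using mult_left_mono[OF d F(1)[of "X (Suc i)"]] by (simp add: algebra_simps)
    also have "F (X (Suc i)) * (\<bar>u - v\<bar> / c\<^sup>2) \<le> A * (\<bar>u - v\<bar> / c\<^sup>2)"
      using F by (intro mult_right_mono) auto
    also have "F (X (Suc i)) * (1 / v) = real n * (LINT x|lborel. F (X (Suc i)) * indicator {X i<..X (Suc i)} x)"
      using Xle[of i "Suc i"] i unfolding inv by simp
    finally show ?thesis by (simp add: u_def v_def)
  qed
  have ind_int: "integrable lborel (\<lambda>x. F (X (Suc i)) * indicator {X i<..X (Suc i)} x)" for i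
    by (cases "X i \<le> X (Suc i)") (auto intro!: integrable_mult_right integrable_real_indicator)
  have "(\<Sum>i<n. (LINT x|lborel. F (X (Suc i)) * indicator {X i<..X (Suc i)} x))
      = (LINT x|lborel. (\<Sum>i<n. F (X (Suc i)) * indicator {X i<..X (Suc i)} x))"
    by (rule Bochner_Integration.integral_sum[symmetric]) (rule ind_int)
  also have "\<dots> \<le> (LINT x|lborel. Q x)"
  proof (rule integral_mono)
    show "integrable lborel (\<lambda>x. \<Sum>i<n. F (X (Suc i)) * indicator {X i<..X (Suc i)} x)"
      by (rule Bochner_Integration.integrable_sum) (rule ind_int)
    show "(\<Sum>i<n. F (X (Suc i)) * indicator {X i<..X (Suc i)} x) \<le> Q x" for x
    proof (cases "\<exists>i<n. x \<in> {X i<..X (Suc i)}")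
      case True
      then obtain i where i: "i < n" "X i < x" "x \<le> X (Suc i)" by auto
      have other: "x \<notin> {X j<..X (Suc j)}" if "j < n" "j \<noteq> i" for j
        using i that Xle[of "Suc i" j] Xle[of "Suc j" i] by (cases "j < i") auto
      have "(\<Sum>j<n. F (X (Suc j)) * indicator {X j<..X (Suc j)} x)
          = (\<Sum>j\<in>{i}. F (X (Suc j)) * indicator {X j<..X (Suc j)} x)"
        by (rule sum.mono_neutral_right) (use i other in auto)
      also have "\<dots> = F (X (Suc i))" using i by simp
      also have "\<dots> \<le> Q x" using i width[OF i(1)] by (intro FQ) auto
      finally show ?thesis .
    next
      case False
      then have "(\<Sum>i<n. F (X (Suc i)) * indicator {X i<..X (Suc i)} x) = 0"
        by (intro sum.neutral) auto
      then show ?thesis using Q(2) by simp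
    qed
  qed (rule Q)
  finally have int_le: "(\<Sum>i<n. (LINT x|lborel. F (X (Suc i)) * indicator {X i<..X (Suc i)} x)) \<le> (LINT x|lborel. Q x)" .
  have "(\<Sum>i\<in>{1..n}. F (X i) / h (X i)) = (\<Sum>i<n. F (X (Suc i)) / h (X (Suc i)))"
    by (simp add: sum.atLeast1_atMost_eq)
  also have "\<dots> \<le> (\<Sum>i<n. real n * (LINT x|lborel. F (X (Suc i)) * indicator {X i<..X (Suc i)} x)
       + A / c\<^sup>2 * \<bar>h (X (Suc i)) - h (\<xi> i)\<bar>)"
    by (intro sum_mono each) auto
  also have "\<dots> = real n * (\<Sum>i<n. (LINT x|lborel. F (X (Suc i)) * indicator {X i<..X (Suc i)} x))
       + A / c\<^sup>2 * (\<Sum>i<n. \<bar>h (X (Suc i)) - h (\<xi> i)\<bar>)"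
    by (simp only: sum.distrib sum_distrib_left)
  also have "\<dots> \<le> real n * (LINT x|lborel. Q x) + A / c\<^sup>2 * V"
    using int_le TV A0 by (intro add_mono mult_left_mono) auto
  finally show ?thesis by (simp add: X_def)
qed

text \<open>
  The leading term is \<open>n\<close> times the squared \<open>L\<^sub>2\<close>-norm of the bump, independently of \<^term>\<open>h\<close>: the factor \<open>1 / h\<close>
  compensates the density of the design points. The majorant used is the squared bump plus its largest
  oscillation within a cell, on the support enlarged by the width of a cell.
\<close>

lemma design_sum_bump_le:
  fixes g :: "real \<Rightarrow> real"
  assumes hpos: "\<And>x. x \<in> {0..1} \<Longrightarrow> h x > (0::real)" and hc: "continuous_on {0..1} h"
    and h1: "(LINT x:{0..1}|lborel. h x) = 1" and n: "n \<ge> 1"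
    and V: "\<And>m t. (\<forall>i\<le>m. t i \<in> {0..1}) \<Longrightarrow> mono_on {..m::nat} t \<Longrightarrow> (\<Sum>i<m. \<bar>h (t (Suc i)) - h (t i)\<bar>) \<le> V"
    and c: "c > 0" "\<And>x. x \<in> {0..1} \<Longrightarrow> h x \<ge> c"
    and g: "\<And>x. \<bar>g x\<bar> \<le> B" "\<And>x y. \<bar>g x - g y\<bar> \<le> B * \<bar>x - y\<bar> powr s" "0 < s"
    and supp: "\<And>x. \<bar>x\<bar> \<ge> K \<Longrightarrow> g x = 0" and K: "K \<ge> 0"
    and g2: "integrable lborel (\<lambda>x. (g x)\<^sup>2)" "(LINT x|lborel. (g x)\<^sup>2) \<le> \<Gamma>"
    and ab: "a \<ge> 0" "b > 0"
  shows "(\<Sum>i\<in>{1..n}. (a * g ((design_point h n i - t) / b))\<^sup>2 / h (design_point h n i))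
     \<le> real n * a\<^sup>2 * b * (\<Gamma> + 4 * B\<^sup>2 * (1 / (real n * c * b)) powr s * (K + 1 / (real n * c * b)) + B\<^sup>2 * V / (c\<^sup>2 * real n * b))"
proof -
  define w where "w = 1 / (real n * c)"
  have npos: "real n > 0" using n by simp
  have w: "w \<ge> 0" using npos c by (simp add: w_def)
  have B0: "B \<ge> 0" using g(1)[of 0] by auto
  define W where "W = a\<^sup>2 * (2 * B\<^sup>2 * (w / b) powr s)"
  have W0: "W \<ge> 0" unfolding W_def by simp
  define T where "T = {t - b * K - w..t + b * K + w}"
  define Q where "Q x = (a * g ((x - t) / b))\<^sup>2 + W * indicator T x" for x
  have sq: "integrable lborel (\<lambda>x. (a * g ((x - t) / b))\<^sup>2)"
    "(LINT x|lborel. (a * g ((x - t) / b))\<^sup>2) = a\<^sup>2 * b * (LINT x|lborel. (g x)\<^sup>2)"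
  proof -
    have eq: "(a * g ((x - t) / b))\<^sup>2 = a\<^sup>2 * (g (- t / b + 1 / b * x))\<^sup>2" for x
      using ab by (simp add: power_mult_distrib diff_divide_distrib add.commute)
    show "integrable lborel (\<lambda>x. (a * g ((x - t) / b))\<^sup>2)"
      unfolding eq using lborel_integrable_real_affine[OF g2(1), of "1 / b" "- t / b"] ab
      by (intro integrable_mult_right) auto
    have "(LINT x|lborel. (g x)\<^sup>2) = 1 / b * (LINT x|lborel. (g (- t / b + 1 / b * x))\<^sup>2)"
      using lborel_integral_real_affine[of "1 / b" "\<lambda>x. (g x)\<^sup>2" "- t / b"] ab by simp
    then show "(LINT x|lborel. (a * g ((x - t) / b))\<^sup>2) = a\<^sup>2 * b * (LINT x|lborel. (g x)\<^sup>2)"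
      unfolding eq using ab by simp
  qed
  have Tint: "integrable lborel (\<lambda>x. W * indicator T x)"
    unfolding T_def by (intro integrable_mult_right integrable_real_indicator) (auto simp: emeasure_lborel_Icc_eq)
  have Qint: "integrable lborel Q" unfolding Q_def[abs_def] using sq(1) Tint by (rule Bochner_Integration.integrable_add)
  have mT: "measure lborel T = 2 * (b * K + w)"
    using K ab w unfolding T_def by (subst measure_lborel_Icc) auto
  have "(LINT x|lborel. Q x) = a\<^sup>2 * b * (LINT x|lborel. (g x)\<^sup>2) + W * (2 * (b * K + w))"
    unfolding Q_def using sq Tint mT by (subst Bochner_Integration.integral_add) (auto simp: T_def)
  also have "\<dots> \<le> a\<^sup>2 * b * \<Gamma> + W * (2 * (b * K + w))"
    using g2(2) ab by (simp add: mult_left_mono)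
  finally have IQ: "(LINT x|lborel. Q x) \<le> a\<^sup>2 * b * \<Gamma> + W * (2 * (b * K + w))" .
  have "(\<Sum>i\<in>{1..n}. (a * g ((design_point h n i - t) / b))\<^sup>2 / h (design_point h n i))
     \<le> real n * (LINT x|lborel. Q x) + (a\<^sup>2 * B\<^sup>2) * V / c\<^sup>2"
  proof (rule design_sum_le_integral[OF hpos hc h1 n V c _ _ Qint, where F = "\<lambda>x. (a * g ((x - t) / b))\<^sup>2"])
    show "(a * g ((x - t) / b))\<^sup>2 \<le> a\<^sup>2 * B\<^sup>2" for x
      using power_mono[OF g(1)[of "(x - t) / b"], of 2] by (simp add: power_mult_distrib mult_left_mono)
    show "0 \<le> Q x" for x using W0 by (auto simp: Q_def indicator_def)
    show "(a * g ((y - t) / b))\<^sup>2 \<le> Q x" if xy: "\<bar>x - y\<bar> \<le> 1 / (real n * c)" for x y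
    proof (cases "\<bar>(y - t) / b\<bar> \<ge> K")
      case True
      then show ?thesis using supp[OF True] W0 by (auto simp: Q_def indicator_def)
    next
      case False
      then have "\<bar>y - t\<bar> < b * K" using ab by (simp add: field_simps)
      then have xT: "x \<in> T" using xy unfolding T_def w_def by auto
      define p q where "p = g ((y - t) / b)" and "q = g ((x - t) / b)"
      have "\<bar>(y - t) / b - (x - t) / b\<bar> = \<bar>x - y\<bar> / b" using ab by (simp add: diff_divide_distrib[symmetric] abs_minus_commute)
      also have "\<dots> \<le> w / b" using xy ab unfolding w_def by (intro divide_right_mono) auto
      finally have "B * \<bar>(y - t) / b - (x - t) / b\<bar> powr s \<le> B * (w / b) powr s"
        using B0 g(3) by (intro mult_left_mono powr_mono2) auto
      then have pq: "\<bar>p - q\<bar> \<le> B * (w / b) powr s" using g(2)[of "(y - t) / b" "(x - t) / b"] by (simp add: p_def q_def)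
      have "p\<^sup>2 - q\<^sup>2 = (p - q) * (p + q)" by (simp add: power2_eq_square algebra_simps)
      also have "\<dots> \<le> \<bar>p - q\<bar> * \<bar>p + q\<bar>" by (metis abs_ge_self abs_mult)
      also have "\<dots> \<le> (B * (w / b) powr s) * (2 * B)"
        using pq g(1)[of "(y - t) / b"] g(1)[of "(x - t) / b"] by (intro mult_mono) (auto simp: p_def q_def)
      finally have "a\<^sup>2 * (p\<^sup>2 - q\<^sup>2) \<le> W" unfolding W_def
        by (intro mult_left_mono) (auto simp: power2_eq_square mult_ac)
      then show ?thesis using xT by (simp add: Q_def p_def q_def power_mult_distrib algebra_simps)
    qed
  qed auto
  also have "\<dots> \<le> real n * (a\<^sup>2 * b * \<Gamma> + W * (2 * (b * K + w))) + (a\<^sup>2 * B\<^sup>2) * V / c\<^sup>2"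
    using IQ npos by simp
  also have "\<dots> = real n * a\<^sup>2 * b * (\<Gamma> + 4 * B\<^sup>2 * (w / b) powr s * (K + w / b) + B\<^sup>2 * V / (c\<^sup>2 * real n * b))"
    using npos ab c by (simp add: W_def field_simps power2_eq_square)
  finally show ?thesis by (simp add: w_def)
qed

section \<open>Mixtures of shifted product measures\<close>

text \<open>
  The average of independent likelihood ratios \<open>Z j\<close> is close to its mean. A weak law of large
  numbers with only \<open>1 + \<delta>\<close> moments suffices: truncating at level \<^term>\<open>m\<close> changes the expectations by at most
  \<^term>\<open>real m powr - \<delta> * Q\<close>, and the average of the truncated variables has a variance of the same order.
  Hence the average over \<^term>\<open>j\<close> of the expectations of \<^term>\<open>\<lambda>\<omega>. Z j \<omega> * \<phi> \<omega>\<close>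
  exceeds that of \<^term>\<open>\<phi>\<close> by little, and some \<^term>\<open>j\<close> does not exceed the average.
\<close>

lemma (in prob_space) exists_weight_with_small_expectation:
  fixes Z :: "nat \<Rightarrow> 'a \<Rightarrow> real" and m :: nat
  assumes m: "m > 0" and ind: "indep_vars (\<lambda>_. borel) Z {..<m}"
    and Z0: "\<And>j \<omega>. j < m \<Longrightarrow> Z j \<omega> \<ge> 0"
    and intZ: "\<And>j. j < m \<Longrightarrow> integrable M (Z j)"
    and EZ: "\<And>j. j < m \<Longrightarrow> expectation (Z j) \<le> 1"
    and \<delta>: "0 < \<delta>" "\<delta> \<le> 1"
    and intP: "\<And>j. j < m \<Longrightarrow> integrable M (\<lambda>\<omega>. Z j \<omega> powr (1 + \<delta>))"
    and EP: "\<And>j. j < m \<Longrightarrow> expectation (\<lambda>\<omega>. Z j \<omega> powr (1 + \<delta>)) \<le> Q"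
    and \<phi>[measurable]: "\<phi> \<in> borel_measurable M"
    and \<phi>01: "\<And>\<omega>. \<omega> \<in> space M \<Longrightarrow> 0 \<le> \<phi> \<omega> \<and> \<phi> \<omega> \<le> 1"
  shows "\<exists>j<m. expectation (\<lambda>\<omega>. Z j \<omega> * \<phi> \<omega>)
           \<le> expectation \<phi> + sqrt (real m powr - \<delta> * Q) + real m powr - \<delta> * Q"
proof (rule ccontr)
  define A where "A = expectation \<phi> + sqrt (real m powr - \<delta> * Q) + real m powr - \<delta> * Q"
  assume "\<not> ?thesis"
  then have contra: "\<And>j. j < m \<Longrightarrow> expectation (\<lambda>\<omega>. Z j \<omega> * \<phi> \<omega>) > A" unfolding A_def by force
  define T where "T j \<omega> = min (Z j \<omega>) (real m)" for j \<omega>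
  define \<mu> where "\<mu> j = expectation (T j)" for j
  have mpos: "real m > 0" using m by simp
  have Zm[measurable]: "Z j \<in> borel_measurable M" if "j < m" for j
    using intZ[OF that] by simp
  have Tm[measurable]: "T j \<in> borel_measurable M" if "j < m" for j
    unfolding T_def using that by measurable
  have T0: "0 \<le> T j \<omega>" "T j \<omega> \<le> m" "T j \<omega> \<le> Z j \<omega>" if "j < m" for j \<omega>
    using Z0[OF that] by (auto simp: T_def)
  have bounded_integrable: "integrable M u" if "u \<in> borel_measurable M" "\<And>\<omega>. \<omega> \<in> space M \<Longrightarrow> \<bar>u \<omega>\<bar> \<le> c" for u :: "'a \<Rightarrow> real" and c
    by (rule integrable_const_bound[where B = c]) (use that in auto)
  have Tint: "integrable M (T j)" if "j < m" for j
    by (rule bounded_integrable[of _ m]) (use that T0 in auto)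
  have \<mu>: "0 \<le> \<mu> j" "\<mu> j \<le> 1" if "j < m" for j
  proof -
    show "0 \<le> \<mu> j" unfolding \<mu>_def using T0[OF that] by (intro Bochner_Integration.integral_nonneg) auto
    have "\<mu> j \<le> expectation (Z j)" unfolding \<mu>_def
      by (rule integral_mono[OF Tint[OF that] intZ[OF that]]) (use T0 that in auto)
    then show "\<mu> j \<le> 1" using EZ[OF that] by simp
  qed
  have \<phi>int: "integrable M \<phi>" by (rule bounded_integrable[of _ 1]) (use \<phi>01 in force)+
  have tail: "Z j \<omega> - T j \<omega> \<le> real m powr - \<delta> * Z j \<omega> powr (1 + \<delta>)" if "j < m" for j \<omega>
  proof (cases "Z j \<omega> \<le> m")
    case True
    then show ?thesis by (simp add: T_def)
  next
    case False
    then have "Z j \<omega> > 0" using m by simp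
    have "real m powr \<delta> \<le> Z j \<omega> powr \<delta>" using False \<delta> by (intro powr_mono2) auto
    then have "1 \<le> real m powr - \<delta> * Z j \<omega> powr \<delta>" using m by (simp add: powr_minus divide_simps)
    then have "Z j \<omega> * 1 \<le> Z j \<omega> * (real m powr - \<delta> * Z j \<omega> powr \<delta>)"
      using \<open>Z j \<omega> > 0\<close> by (intro mult_left_mono) auto
    also have "\<dots> = real m powr - \<delta> * Z j \<omega> powr (1 + \<delta>)"
      using \<open>Z j \<omega> > 0\<close> by (simp add: powr_add)
    finally show ?thesis using T0[OF that, of \<omega>] by simp
  qed
  have square: "(T j \<omega>)\<^sup>2 \<le> real m powr (1 - \<delta>) * Z j \<omega> powr (1 + \<delta>)" if "j < m" for j \<omega>
  proof (cases "T j \<omega> = 0")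
    case False
    then have T: "T j \<omega> > 0" using T0[OF that, of \<omega>] by simp
    have "(T j \<omega>)\<^sup>2 = T j \<omega> powr (1 - \<delta>) * T j \<omega> powr (1 + \<delta>)"
      using T by (simp add: powr_add[symmetric])
    also have "\<dots> \<le> real m powr (1 - \<delta>) * Z j \<omega> powr (1 + \<delta>)"
      using T T0[OF that, of \<omega>] \<delta> by (intro mult_mono powr_mono2) auto
    finally show ?thesis .
  qed auto
  have T2int: "integrable M (\<lambda>\<omega>. (T j \<omega>)\<^sup>2)" if "j < m" for j
    by (rule bounded_integrable[of _ "(real m)\<^sup>2"]) (use that T0 in \<open>auto intro!: power_mono\<close>)
  have var: "expectation (\<lambda>\<omega>. (T j \<omega> - \<mu> j)\<^sup>2) \<le> real m powr (1 - \<delta>) * Q" if "j < m" for j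
  proof -
    have "expectation (\<lambda>\<omega>. (T j \<omega> - \<mu> j)\<^sup>2) = expectation (\<lambda>\<omega>. (T j \<omega>)\<^sup>2) - (\<mu> j)\<^sup>2"
      unfolding \<mu>_def by (rule variance_eq[OF Tint[OF that] T2int[OF that]])
    also have "\<dots> \<le> expectation (\<lambda>\<omega>. (T j \<omega>)\<^sup>2)" by simp
    also have "\<dots> \<le> expectation (\<lambda>\<omega>. real m powr (1 - \<delta>) * Z j \<omega> powr (1 + \<delta>))"
      by (rule integral_mono[OF T2int[OF that]]) (use intP that square in auto)
    also have "\<dots> \<le> real m powr (1 - \<delta>) * Q" using EP[OF that] by (simp add: mult_left_mono)
    finally show ?thesis .
  qed
  have indT: "indep_vars (\<lambda>_. borel) T {..<m}"
    using indep_vars_compose2[OF ind, of "\<lambda>_ z. min z (real m)" "\<lambda>_. borel"] by (simp add: T_def[abs_def])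
  have cov: "expectation (\<lambda>\<omega>. (T j \<omega> - \<mu> j) * (T k \<omega> - \<mu> k)) = 0" if "j < m" "k < m" "j \<noteq> k" for j k
  proof -
    have "indep_vars (\<lambda>_. borel) (\<lambda>j \<omega>. T j \<omega> - \<mu> j) {j, k}"
      using indep_vars_compose2[OF indep_vars_subset[OF indT, of "{j, k}"], of "\<lambda>j z. z - \<mu> j" "\<lambda>_. borel"] that by auto
    moreover have "integrable M (\<lambda>\<omega>. T i \<omega> - \<mu> i)" if "i \<in> {j, k}" for i
      using Tint[of i] that \<open>j < m\<close> \<open>k < m\<close> by auto
    ultimately have "expectation (\<lambda>\<omega>. \<Prod>i\<in>{j, k}. T i \<omega> - \<mu> i) = (\<Prod>i\<in>{j, k}. expectation (\<lambda>\<omega>. T i \<omega> - \<mu> i))"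
      by (intro indep_vars_lebesgue_integral) auto
    then show ?thesis using that Tint by (simp add: \<mu>_def prob_space)
  qed
  define S where "S \<omega> = (\<Sum>j<m. T j \<omega> - \<mu> j)" for \<omega>
  have Sm[measurable]: "S \<in> borel_measurable M" unfolding S_def by measurable
  have Tb: "\<bar>T j \<omega> - \<mu> j\<bar> \<le> real m" if "j < m" for j \<omega>
    using T0[OF that, of \<omega>] \<mu>[OF that] m by auto
  have prodint: "integrable M (\<lambda>\<omega>. (T j \<omega> - \<mu> j) * (T k \<omega> - \<mu> k))" if "j < m" "k < m" for j k
    by (rule bounded_integrable[of _ "real m * real m"]) (use that Tb in \<open>auto simp: abs_mult intro!: mult_mono\<close>)
  have "expectation (\<lambda>\<omega>. (S \<omega>)\<^sup>2) = expectation (\<lambda>\<omega>. \<Sum>j<m. \<Sum>k<m. (T j \<omega> - \<mu> j) * (T k \<omega> - \<mu> k))"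
    unfolding S_def power2_eq_square sum_product ..
  also have "\<dots> = (\<Sum>j<m. \<Sum>k<m. expectation (\<lambda>\<omega>. (T j \<omega> - \<mu> j) * (T k \<omega> - \<mu> k)))"
    by (subst Bochner_Integration.integral_sum, use prodint in \<open>force intro!: Bochner_Integration.integrable_sum\<close>,
        intro sum.cong refl Bochner_Integration.integral_sum) (use prodint in auto)
  also have "\<dots> = (\<Sum>j<m. \<Sum>k<m. if j = k then expectation (\<lambda>\<omega>. (T j \<omega> - \<mu> j)\<^sup>2) else 0)"
    using cov by (intro sum.cong) (auto simp: power2_eq_square)
  also have "\<dots> = (\<Sum>j<m. expectation (\<lambda>\<omega>. (T j \<omega> - \<mu> j)\<^sup>2))" by simp
  also have "\<dots> \<le> (\<Sum>j<m. real m powr (1 - \<delta>) * Q)" by (intro sum_mono var) auto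
  also have "\<dots> = (real m)\<^sup>2 * (real m powr - \<delta> * Q)"
    using mpos by (simp add: powr_diff powr_minus power2_eq_square field_simps)
  finally have ES2: "expectation (\<lambda>\<omega>. (S \<omega>)\<^sup>2) \<le> (real m)\<^sup>2 * (real m powr - \<delta> * Q)" .
  have Sb: "\<bar>S \<omega>\<bar> \<le> real m * real m" for \<omega>
  proof -
    have "\<bar>S \<omega>\<bar> \<le> (\<Sum>j<m. \<bar>T j \<omega> - \<mu> j\<bar>)" unfolding S_def by (rule sum_abs)
    also have "\<dots> \<le> (\<Sum>j<m. real m)" using Tb by (intro sum_mono) auto
    finally show ?thesis by simp
  qed
  have Sint: "integrable M (\<lambda>\<omega>. \<bar>S \<omega>\<bar>)" by (rule bounded_integrable[of _ "real m * real m"]) (use Sb in auto)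
  have S2int: "integrable M (\<lambda>\<omega>. (S \<omega>)\<^sup>2)"
    by (rule bounded_integrable[of _ "(real m * real m)\<^sup>2"]) (use Sb in \<open>auto simp: abs_le_square_iff[symmetric]\<close>)
  have "0 \<le> variance (\<lambda>\<omega>. \<bar>S \<omega>\<bar>)" by (rule variance_positive)
  also have "\<dots> = expectation (\<lambda>\<omega>. \<bar>S \<omega>\<bar>\<^sup>2) - (expectation (\<lambda>\<omega>. \<bar>S \<omega>\<bar>))\<^sup>2"
    by (rule variance_eq) (use Sint S2int in auto)
  finally have "(expectation (\<lambda>\<omega>. \<bar>S \<omega>\<bar>))\<^sup>2 \<le> expectation (\<lambda>\<omega>. (S \<omega>)\<^sup>2)" by simp
  also note ES2
  finally have "expectation (\<lambda>\<omega>. \<bar>S \<omega>\<bar>) \<le> sqrt ((real m)\<^sup>2 * (real m powr - \<delta> * Q))"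
    by (rule real_le_rsqrt)
  then have ES: "expectation (\<lambda>\<omega>. \<bar>S \<omega>\<bar>) \<le> real m * sqrt (real m powr - \<delta> * Q)"
    by (simp add: real_sqrt_mult)
  have T\<phi>: "integrable M (\<lambda>\<omega>. T j \<omega> * \<phi> \<omega>)" if "j < m" for j
    by (rule bounded_integrable[of _ "real m * 1"])
       (use that T0 \<phi>01 in \<open>auto simp: abs_mult intro!: mult_mono simp del: mult_1_right\<close>)
  have S\<phi>: "integrable M (\<lambda>\<omega>. S \<omega> * \<phi> \<omega>)"
    by (rule bounded_integrable[of _ "(real m * real m) * 1"])
       (use Sb \<phi>01 in \<open>auto simp: abs_mult intro!: mult_mono simp del: mult_1_right\<close>)
  have Z\<phi>: "integrable M (\<lambda>\<omega>. Z j \<omega> * \<phi> \<omega>)" if "j < m" for j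
    by (rule Bochner_Integration.integrable_bound[OF intZ[OF that]])
       (use that Z0[OF that] \<phi>01 in \<open>auto intro!: AE_I2 mult_left_le simp: abs_mult\<close>)
  have step: "expectation (\<lambda>\<omega>. Z j \<omega> * \<phi> \<omega>) \<le> expectation (\<lambda>\<omega>. T j \<omega> * \<phi> \<omega>) + real m powr - \<delta> * Q" if "j < m" for j
  proof -
    have "expectation (\<lambda>\<omega>. Z j \<omega> * \<phi> \<omega>) \<le> expectation (\<lambda>\<omega>. T j \<omega> * \<phi> \<omega> + real m powr - \<delta> * Z j \<omega> powr (1 + \<delta>))"
    proof (rule integral_mono[OF Z\<phi>[OF that]])
      show "integrable M (\<lambda>\<omega>. T j \<omega> * \<phi> \<omega> + real m powr - \<delta> * Z j \<omega> powr (1 + \<delta>))"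
        using T\<phi> intP that by auto
      fix \<omega> assume "\<omega> \<in> space M"
      then have "(Z j \<omega> - T j \<omega>) * \<phi> \<omega> \<le> Z j \<omega> - T j \<omega>"
        using \<phi>01[of \<omega>] T0[OF that, of \<omega>] by (intro mult_left_le) auto
      then show "Z j \<omega> * \<phi> \<omega> \<le> T j \<omega> * \<phi> \<omega> + real m powr - \<delta> * Z j \<omega> powr (1 + \<delta>)"
        using tail[OF that, of \<omega>] by (simp add: algebra_simps)
    qed
    also have "\<dots> = expectation (\<lambda>\<omega>. T j \<omega> * \<phi> \<omega>) + real m powr - \<delta> * expectation (\<lambda>\<omega>. Z j \<omega> powr (1 + \<delta>))"
      using T\<phi>[OF that] intP[OF that] by simp
    also have "\<dots> \<le> expectation (\<lambda>\<omega>. T j \<omega> * \<phi> \<omega>) + real m powr - \<delta> * Q"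
      using EP[OF that] by (simp add: mult_left_mono)
    finally show ?thesis .
  qed
  have "real m * A = (\<Sum>j<m. A)" by simp
  also have "\<dots> < (\<Sum>j<m. expectation (\<lambda>\<omega>. Z j \<omega> * \<phi> \<omega>))"
    using contra m by (intro sum_strict_mono) auto
  also have "\<dots> \<le> (\<Sum>j<m. expectation (\<lambda>\<omega>. T j \<omega> * \<phi> \<omega>) + real m powr - \<delta> * Q)"
    by (intro sum_mono step) auto
  also have "\<dots> = expectation (\<lambda>\<omega>. \<Sum>j<m. T j \<omega> * \<phi> \<omega>) + real m * (real m powr - \<delta> * Q)"
    using T\<phi> by (simp add: sum.distrib)
  also have "expectation (\<lambda>\<omega>. \<Sum>j<m. T j \<omega> * \<phi> \<omega>) = expectation (\<lambda>\<omega>. S \<omega> * \<phi> \<omega> + (\<Sum>j<m. \<mu> j) * \<phi> \<omega>)"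
    by (intro arg_cong[where f = expectation] ext)
       (simp add: S_def sum_subtractf left_diff_distrib sum_distrib_right)
  also have "\<dots> = expectation (\<lambda>\<omega>. S \<omega> * \<phi> \<omega>) + (\<Sum>j<m. \<mu> j) * expectation \<phi>"
    using S\<phi> \<phi>int by simp
  also have "\<dots> \<le> expectation (\<lambda>\<omega>. \<bar>S \<omega>\<bar>) + real m * expectation \<phi>"
  proof (intro add_mono mult_right_mono)
    show "expectation (\<lambda>\<omega>. S \<omega> * \<phi> \<omega>) \<le> expectation (\<lambda>\<omega>. \<bar>S \<omega>\<bar>)"
    proof (rule integral_mono[OF S\<phi> Sint])
      fix \<omega> assume "\<omega> \<in> space M"
      then have "\<bar>S \<omega>\<bar> * \<phi> \<omega> \<le> \<bar>S \<omega>\<bar>" "S \<omega> * \<phi> \<omega> \<le> \<bar>S \<omega>\<bar> * \<phi> \<omega>"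
        using \<phi>01[of \<omega>] by (auto intro!: mult_left_le mult_right_mono)
      then show "S \<omega> * \<phi> \<omega> \<le> \<bar>S \<omega>\<bar>" by linarith
    qed
    show "(\<Sum>j<m. \<mu> j) \<le> real m" using sum_mono[of "{..<m}" \<mu> "\<lambda>_. 1"] \<mu> by simp
    show "0 \<le> expectation \<phi>" using \<phi>01 by (intro Bochner_Integration.integral_nonneg) auto
  qed
  also have "\<dots> \<le> real m * sqrt (real m powr - \<delta> * Q) + real m * expectation \<phi>" using ES by simp
  finally have "real m * A < real m * A" by (simp add: A_def algebra_simps)
  then show False by simp
qed

text \<open>
  Both measures agree on rectangles, where the integral of a product factorizes.
\<close>

lemma PiM_density_eq_density_PiM:
  fixes f :: "real \<Rightarrow> real" and g :: "'i \<Rightarrow> real \<Rightarrow> real"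
  assumes I: "finite I" and f[measurable]: "f \<in> borel_measurable borel" and fpos: "\<And>x. f x > 0"
    and g[measurable]: "\<And>i. g i \<in> borel_measurable borel" and g0: "\<And>i x. g i x \<ge> 0"
    and pf: "prob_space (density lborel f)" and pg: "\<And>i. prob_space (density lborel (g i))"
  shows "density (PiM I (\<lambda>_. density lborel f)) (\<lambda>y. ennreal (\<Prod>i\<in>I. g i (y i) / f (y i)))
       = PiM I (\<lambda>i. density lborel (g i))"
proof -
  interpret G: product_sigma_finite "\<lambda>i. density lborel (g i)"
    by (rule product_sigma_finite.intro) (use pg prob_space_imp_sigma_finite in auto)
  interpret F: product_sigma_finite "\<lambda>i::'i. density lborel f"
    by (rule product_sigma_finite.intro) (use pf prob_space_imp_sigma_finite in auto)
  have [measurable_cong]: "sets (PiM I (\<lambda>_. density lborel f)) = sets (PiM I (\<lambda>_. borel))"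
    by (rule sets_PiM_cong) auto
  show ?thesis
  proof (rule G.PiM_eqI[OF I])
    show "sets (density (PiM I (\<lambda>_. density lborel f)) (\<lambda>y. ennreal (\<Prod>i\<in>I. g i (y i) / f (y i))))
       = sets (PiM I (\<lambda>i. density lborel (g i)))"
      unfolding sets_density by (rule sets_PiM_cong) auto
    fix A assume A: "\<And>i. i \<in> I \<Longrightarrow> A i \<in> sets (density lborel (g i))"
    then have A': "\<And>i. i \<in> I \<Longrightarrow> A i \<in> sets borel" by simp
    have AP: "Pi\<^sub>E I A \<in> sets (PiM I (\<lambda>_. density lborel f))"
      using A' I by (intro sets_PiM_I_finite) auto
    have "emeasure (density (PiM I (\<lambda>_. density lborel f)) (\<lambda>y. ennreal (\<Prod>i\<in>I. g i (y i) / f (y i)))) (Pi\<^sub>E I A)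
       = (\<integral>\<^sup>+ y. ennreal (\<Prod>i\<in>I. g i (y i) / f (y i)) * indicator (Pi\<^sub>E I A) y \<partial>PiM I (\<lambda>_. density lborel f))"
      by (rule emeasure_density[OF _ AP]) measurable
    also have "\<dots> = (\<integral>\<^sup>+ y. (\<Prod>i\<in>I. ennreal (g i (y i) / f (y i)) * indicator (A i) (y i)) \<partial>PiM I (\<lambda>_. density lborel f))"
    proof (rule nn_integral_cong)
      fix y assume "y \<in> space (PiM I (\<lambda>_. density lborel f))"
      then have y: "y \<in> extensional I" by (auto simp: space_PiM PiE_def)
      have "indicator (Pi\<^sub>E I A) y = (\<Prod>i\<in>I. indicator (A i) (y i) :: ennreal)"
        using y I by (auto simp: indicator_def PiE_def Pi_def prod_zero_iff)
      moreover have "ennreal (\<Prod>i\<in>I. g i (y i) / f (y i)) = (\<Prod>i\<in>I. ennreal (g i (y i) / f (y i)))"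
        using g0 fpos by (intro prod_ennreal[symmetric]) (simp add: less_imp_le)
      ultimately show "ennreal (\<Prod>i\<in>I. g i (y i) / f (y i)) * indicator (Pi\<^sub>E I A) y
          = (\<Prod>i\<in>I. ennreal (g i (y i) / f (y i)) * indicator (A i) (y i))"
        by (simp add: prod.distrib)
    qed
    also have "\<dots> = (\<Prod>i\<in>I. \<integral>\<^sup>+ x. ennreal (g i x / f x) * indicator (A i) x \<partial>density lborel f)"
      by (rule F.product_nn_integral_prod[OF I]) (use A' in auto)
    also have "\<dots> = (\<Prod>i\<in>I. emeasure (density lborel (g i)) (A i))"
    proof (rule prod.cong[OF refl])
      fix i assume i: "i \<in> I"
      have [measurable]: "A i \<in> sets borel" using A' i by auto
      have "(\<integral>\<^sup>+ x. ennreal (g i x / f x) * indicator (A i) x \<partial>density lborel f)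
         = (\<integral>\<^sup>+ x. ennreal (f x) * (ennreal (g i x / f x) * indicator (A i) x) \<partial>lborel)"
        by (rule nn_integral_density) auto
      also have "\<dots> = (\<integral>\<^sup>+ x. ennreal (g i x) * indicator (A i) x \<partial>lborel)"
        using fpos g0 by (intro nn_integral_cong)
          (simp add: mult.assoc[symmetric] ennreal_mult[symmetric] less_imp_le, metis less_irrefl)
      also have "\<dots> = emeasure (density lborel (g i)) (A i)"
        by (rule emeasure_density[symmetric]) auto
      finally show "(\<integral>\<^sup>+ x. ennreal (g i x / f x) * indicator (A i) x \<partial>density lborel f)
         = emeasure (density lborel (g i)) (A i)" .
    qed
    finally show "emeasure (density (PiM I (\<lambda>_. density lborel f)) (\<lambda>y. ennreal (\<Prod>i\<in>I. g i (y i) / f (y i)))) (Pi\<^sub>E I A)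
       = (\<Prod>i\<in>I. emeasure (density lborel (g i)) (A i))" .
  qed
qed

lemma (in prob_space) borel_measurable_of_distributed_density:
  assumes "distributed M lborel X (\<lambda>x. ennreal (f x))" "\<And>x. f x > (0::real)"
  shows "f \<in> borel_measurable borel"
proof -
  have "(\<lambda>x. enn2real (ennreal (f x))) \<in> borel_measurable borel"
    using distributed_borel_measurable[OF assms(1)] by simp
  then show ?thesis using assms(2) by (simp add: less_imp_le)
qed

text \<open>
  The density of a translated error is the original density times a ratio, and for independent errors the
  ratios multiply. This expresses all alternatives under one and the same measure.
\<close>

lemma (in prob_space) shifted_sample_expectation:
  fixes X :: "'i \<Rightarrow> 'a \<Rightarrow> real" and f :: "real \<Rightarrow> real"
  assumes I: "finite I" "I \<noteq> {}" and ind: "indep_vars (\<lambda>_. borel) X I"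
    and dist: "\<And>i. i \<in> I \<Longrightarrow> distributed M lborel (X i) (\<lambda>x. ennreal (f x))"
    and fpos: "\<And>x. f x > 0"
    and \<phi>[measurable]: "\<phi> \<in> borel_measurable (\<Pi>\<^sub>M i\<in>I. borel)"
  shows "(LINT \<omega>|M. \<phi> (\<lambda>i\<in>I. \<theta> i + X i \<omega>))
       = (LINT \<omega>|M. (\<Prod>i\<in>I. f (X i \<omega> - \<theta> i) / f (X i \<omega>)) * \<phi> (\<lambda>i\<in>I. X i \<omega>))"
proof -
  obtain i0 where i0: "i0 \<in> I" using I by auto
  have f[measurable]: "f \<in> borel_measurable borel"
    by (rule borel_measurable_of_distributed_density[OF dist[OF i0] fpos])
  have X[measurable]: "X i \<in> borel_measurable M" if "i \<in> I" for i
    using distributed_measurable[OF dist[OF that]] by simp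
  define P where "P = PiM I (\<lambda>_. density lborel f)"
  have sets_P[measurable_cong]: "sets P = sets (PiM I (\<lambda>_. borel))"
    unfolding P_def by (rule sets_PiM_cong) auto
  have distX: "distr M borel (X i) = density lborel f" if "i \<in> I" for i
    using distributed_distr_eq_density[OF dist[OF that]]
    by (simp cong: distr_cong)
  have shift: "distributed M lborel (\<lambda>\<omega>. \<theta> i + X i \<omega>) (\<lambda>x. ennreal (f (x - \<theta> i)))" if "i \<in> I" for i
    using distributed_affine[OF dist[OF that], of 1 "\<theta> i"] by (simp add: divide_ennreal_def)
  have distS: "distr M borel (\<lambda>\<omega>. \<theta> i + X i \<omega>) = density lborel (\<lambda>x. f (x - \<theta> i))" if "i \<in> I" for i
    using distributed_distr_eq_density[OF shift[OF that]]
    by (simp cong: distr_cong)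
  have p0: "prob_space (density lborel (\<lambda>x. f (x - \<theta> i)))" if "i \<in> I" for i
    unfolding distS[OF that, symmetric] by (rule prob_space_distr) (use that in measurable)
  have pf: "prob_space (density lborel f)"
    unfolding distX[OF i0, symmetric] by (rule prob_space_distr) (use i0 in measurable)
  define g where "g i x = f (x - (if i \<in> I then \<theta> i else 0))" for i x
  have gI: "i \<in> I \<Longrightarrow> g i = (\<lambda>x. f (x - \<theta> i))" for i by (auto simp: g_def)
  have pg: "prob_space (density lborel (g i))" for i
    using p0[of i] pf by (cases "i \<in> I") (auto simp: g_def)
  have g[measurable]: "g i \<in> borel_measurable borel" for i unfolding g_def by measurable
  have law0: "distr M (PiM I (\<lambda>_. borel)) (\<lambda>\<omega>. \<lambda>i\<in>I. X i \<omega>) = P"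
    unfolding P_def using iffD1[OF indep_vars_iff_distr_eq_PiM'[OF I(2)] ind] X
    by (simp add: distX cong: PiM_cong)
  have indS: "indep_vars (\<lambda>_. borel) (\<lambda>i \<omega>. \<theta> i + X i \<omega>) I"
    using indep_vars_compose2[OF ind, of "\<lambda>i x. \<theta> i + x" "\<lambda>_. borel"] by simp
  have "distr M (PiM I (\<lambda>_. borel)) (\<lambda>\<omega>. \<lambda>i\<in>I. \<theta> i + X i \<omega>) = PiM I (\<lambda>i. distr M borel (\<lambda>\<omega>. \<theta> i + X i \<omega>))"
    by (rule iffD1[OF indep_vars_iff_distr_eq_PiM'[OF I(2)] indS]) (use X in measurable)
  also have "\<dots> = PiM I (\<lambda>i. density lborel (g i))"
    by (rule PiM_cong) (auto simp: distS gI)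
  also have "\<dots> = density P (\<lambda>y. ennreal (\<Prod>i\<in>I. g i (y i) / f (y i)))"
    unfolding P_def by (rule PiM_density_eq_density_PiM[symmetric]) (use I fpos pf pg in \<open>auto simp: g_def less_imp_le\<close>)
  also have "\<dots> = density P (\<lambda>y. ennreal (\<Prod>i\<in>I. f (y i - \<theta> i) / f (y i)))"
    by (simp add: gI cong: prod.cong)
  finally have lawS: "distr M (PiM I (\<lambda>_. borel)) (\<lambda>\<omega>. \<lambda>i\<in>I. \<theta> i + X i \<omega>)
      = density P (\<lambda>y. ennreal (\<Prod>i\<in>I. f (y i - \<theta> i) / f (y i)))" .
  have "(LINT \<omega>|M. \<phi> (\<lambda>i\<in>I. \<theta> i + X i \<omega>)) = (LINT y|distr M (PiM I (\<lambda>_. borel)) (\<lambda>\<omega>. \<lambda>i\<in>I. \<theta> i + X i \<omega>). \<phi> y)"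
    by (rule integral_distr[symmetric]) (use X in measurable)
  also have "\<dots> = (LINT y|P. (\<Prod>i\<in>I. f (y i - \<theta> i) / f (y i)) * \<phi> y)"
    unfolding lawS
    by (subst integral_density) (use fpos in \<open>auto intro!: AE_I2 prod_nonneg simp: less_imp_le\<close>)
  also have "\<dots> = (LINT \<omega>|M. (\<Prod>i\<in>I. f ((\<lambda>i\<in>I. X i \<omega>) i - \<theta> i) / f ((\<lambda>i\<in>I. X i \<omega>) i)) * \<phi> (\<lambda>i\<in>I. X i \<omega>))"
    unfolding law0[symmetric] by (rule integral_distr) (use X in measurable)
  finally show ?thesis by simp
qed

text \<open>
  The likelihood ratio of the \<open>j\<close>th shift depends only on the coordinates that it moves. Shifts of
  disjoint sets of coordinates thus have independent likelihood ratios, to which the law of large numbers above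
  applies.
\<close>

lemma (in prob_space) exists_undetectable_shift:
  fixes X :: "'i \<Rightarrow> 'a \<Rightarrow> real" and f :: "real \<Rightarrow> real" and \<theta> :: "nat \<Rightarrow> 'i \<Rightarrow> real" and m :: nat
  assumes I: "finite I" "I \<noteq> {}" and ind: "indep_vars (\<lambda>_. borel) X I"
    and dist: "\<And>i. i \<in> I \<Longrightarrow> distributed M lborel (X i) (\<lambda>x. ennreal (f x))"
    and fpos: "\<And>x. f x > 0"
    and \<phi>[measurable]: "\<phi> \<in> borel_measurable (\<Pi>\<^sub>M i\<in>I. borel)"
    and \<phi>01: "\<And>y. y \<in> space (\<Pi>\<^sub>M i\<in>I. (borel :: real measure)) \<Longrightarrow> 0 \<le> \<phi> y \<and> \<phi> y \<le> 1"
    and m: "m > 0"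
    and disj: "\<And>j k i. j < m \<Longrightarrow> k < m \<Longrightarrow> j \<noteq> k \<Longrightarrow> i \<in> I \<Longrightarrow> \<theta> j i = 0 \<or> \<theta> k i = 0"
    and \<delta>: "0 < \<delta>" "\<delta> \<le> 1"
    and intP: "\<And>j i. j < m \<Longrightarrow> i \<in> I \<Longrightarrow> integrable lborel (\<lambda>z. (f (z - \<theta> j i) / f z) powr (1 + \<delta>) * f z)"
    and Q: "\<And>j. j < m \<Longrightarrow> (\<Prod>i\<in>I. LINT z|lborel. (f (z - \<theta> j i) / f z) powr (1 + \<delta>) * f z) \<le> Q"
  shows "\<exists>j<m. (LINT \<omega>|M. \<phi> (\<lambda>i\<in>I. \<theta> j i + X i \<omega>)) \<le> (LINT \<omega>|M. \<phi> (\<lambda>i\<in>I. X i \<omega>))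
           + sqrt (real m powr - \<delta> * Q) + real m powr - \<delta> * Q"
proof -
  obtain i0 where i0: "i0 \<in> I" using I by auto
  have f[measurable]: "f \<in> borel_measurable borel"
    by (rule borel_measurable_of_distributed_density[OF dist[OF i0] fpos])
  have X[measurable]: "X i \<in> borel_measurable M" if "i \<in> I" for i
    using distributed_measurable[OF dist[OF that]] by simp
  define Z where "Z j \<omega> = (\<Prod>i\<in>I. f (X i \<omega> - \<theta> j i) / f (X i \<omega>))" for j \<omega>
  have expect: "integrable M (\<lambda>\<omega>. \<Prod>i\<in>I. g i (X i \<omega>))"
      "expectation (\<lambda>\<omega>. \<Prod>i\<in>I. g i (X i \<omega>)) = (\<Prod>i\<in>I. LINT z|lborel. g i z * f z)"
    if gm: "\<And>i. i \<in> I \<Longrightarrow> g i \<in> borel_measurable borel" and gi: "\<And>i. i \<in> I \<Longrightarrow> integrable lborel (\<lambda>z. g i z * f z)"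
    for g :: "'i \<Rightarrow> real \<Rightarrow> real"
  proof -
    have indg: "indep_vars (\<lambda>_. borel) (\<lambda>i \<omega>. g i (X i \<omega>)) I"
      using indep_vars_compose2[OF ind, of g "\<lambda>_. borel"] gm by simp
    have gint: "integrable M (\<lambda>\<omega>. g i (X i \<omega>))" if "i \<in> I" for i
      using distributed_integrable[OF dist[OF that], of "g i"] gm[OF that] gi[OF that] fpos
      by (simp add: mult.commute less_imp_le)
    have geq: "expectation (\<lambda>\<omega>. g i (X i \<omega>)) = (LINT z|lborel. g i z * f z)" if "i \<in> I" for i
      using distributed_integral[OF dist[OF that], of "g i"] gm[OF that] fpos
      by (simp add: mult.commute less_imp_le)
    show "integrable M (\<lambda>\<omega>. \<Prod>i\<in>I. g i (X i \<omega>))"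
      by (rule indep_vars_integrable[OF I(1) indg gint])
    show "expectation (\<lambda>\<omega>. \<Prod>i\<in>I. g i (X i \<omega>)) = (\<Prod>i\<in>I. LINT z|lborel. g i z * f z)"
      by (subst indep_vars_lebesgue_integral[OF I(1) indg gint]) (auto simp: geq intro!: prod.cong)
  qed
  have fint: "integrable lborel f" "(LINT z|lborel. f z) = 1"
  proof -
    show "integrable lborel f"
      using distributed_integrable[OF dist[OF i0], of "\<lambda>_. 1"] fpos by (simp add: less_imp_le)
    show "(LINT z|lborel. f z) = 1"
      using distributed_integral[OF dist[OF i0], of "\<lambda>_. 1"] fpos by (simp add: less_imp_le prob_space)
  qed
  have ratio: "f (z - a) / f z * f z = f (z - a)" for z a using fpos[of z] by simp
  have fshift: "integrable lborel (\<lambda>z. f (z - a))" "(LINT z|lborel. f (z - a)) = 1" for a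
    using lborel_integrable_real_affine[of f 1 "- a"] lborel_integral_real_affine[of 1 f "- a"] fint
    by (auto simp: algebra_simps)
  have Zpowr: "Z j \<omega> powr (1 + \<delta>) = (\<Prod>i\<in>I. (f (X i \<omega> - \<theta> j i) / f (X i \<omega>)) powr (1 + \<delta>))" for j \<omega>
    unfolding Z_def by (rule prod_powr_distrib)
  define S where "S j = {i \<in> I. \<theta> j i \<noteq> 0}" for j
  have ZS: "Z j \<omega> = (\<Prod>i\<in>S j. f (X i \<omega> - \<theta> j i) / f (X i \<omega>))" for j \<omega>
    unfolding Z_def S_def using I fpos
    by (intro prod.mono_neutral_right) (auto simp: less_imp_neq[symmetric])
  have "indep_vars (\<lambda>j. PiM (S j) (\<lambda>_. borel)) (\<lambda>j \<omega>. restrict (\<lambda>i. X i \<omega>) (S j)) {..<m}"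
    using disj by (intro indep_vars_restrict[OF ind]) (auto simp: S_def disjoint_family_on_def)
  from indep_vars_compose2[OF this, of "\<lambda>j y. \<Prod>i\<in>S j. f (y i - \<theta> j i) / f (y i)" "\<lambda>_. borel"]
  have indZ: "indep_vars (\<lambda>_. borel) Z {..<m}"
    by (simp add: ZS[abs_def] restrict_def cong: prod.cong)
  have "\<exists>j<m. expectation (\<lambda>\<omega>. Z j \<omega> * \<phi> (\<lambda>i\<in>I. X i \<omega>))
           \<le> expectation (\<lambda>\<omega>. \<phi> (\<lambda>i\<in>I. X i \<omega>)) + sqrt (real m powr - \<delta> * Q) + real m powr - \<delta> * Q"
  proof (rule exists_weight_with_small_expectation[OF m indZ _ _ _ \<delta>])
    show "Z j \<omega> \<ge> 0" for j \<omega> unfolding Z_def using fpos by (intro prod_nonneg) (simp add: less_imp_le)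
    show "integrable M (Z j)" for j
      unfolding Z_def[abs_def] using expect(1)[of "\<lambda>i z. f (z - \<theta> j i) / f z"] fshift ratio by simp
    show "expectation (Z j) \<le> 1" for j
      unfolding Z_def[abs_def] using expect(2)[of "\<lambda>i z. f (z - \<theta> j i) / f z"] fshift ratio by simp
    show "integrable M (\<lambda>\<omega>. Z j \<omega> powr (1 + \<delta>))" if "j < m" for j
      unfolding Zpowr using expect(1)[of "\<lambda>i z. (f (z - \<theta> j i) / f z) powr (1 + \<delta>)"] intP[OF that] by simp
    show "expectation (\<lambda>\<omega>. Z j \<omega> powr (1 + \<delta>)) \<le> Q" if "j < m" for j
      unfolding Zpowr using expect(2)[of "\<lambda>i z. (f (z - \<theta> j i) / f z) powr (1 + \<delta>)"] intP[OF that] Q[OF that] by simp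
    show "(\<lambda>\<omega>. \<phi> (\<lambda>i\<in>I. X i \<omega>)) \<in> borel_measurable M"
      using X by measurable
    show "0 \<le> \<phi> (\<lambda>i\<in>I. X i \<omega>) \<and> \<phi> (\<lambda>i\<in>I. X i \<omega>) \<le> 1" for \<omega>
      by (rule \<phi>01) (auto simp: space_PiM)
  qed
  moreover have "(LINT \<omega>|M. \<phi> (\<lambda>i\<in>I. \<theta> j i + X i \<omega>)) = expectation (\<lambda>\<omega>. Z j \<omega> * \<phi> (\<lambda>i\<in>I. X i \<omega>))" for j
    unfolding Z_def by (rule shifted_sample_expectation[OF I ind dist fpos \<phi>])
  ultimately show ?thesis by simp
qed

section \<open>Asymptotics of bump parameters\<close>

text \<open>
  All corrections to the leading term of the signal energy are \<open>o(1 / sqrt (ln n))\<close> and hence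
  negligible against \<open>\<epsilon>\<^sub>n\<close>. The cutoff scale \<open>exp (sqrt (ln n))\<close> is chosen for this: positive powers of it dominate
  all powers of \<open>ln n\<close>, whereas it is dominated by all positive powers of \<open>n\<close>.
\<close>

lemma bump_excess_negligible:
  fixes C C' A A' s \<beta> q \<kappa> c :: real
  assumes "C \<ge> 0" "0 < s" "\<beta> > 0" and q: "q > 0" and \<kappa>: "0 < \<kappa>" "\<kappa> < 1" and c: "c > 0"
  defines "\<sigma> \<equiv> \<lambda>n::nat. sqrt (ln (real n))"
    and "b \<equiv> \<lambda>n::nat. q * (ln (real n) / real n) powr \<kappa>"
  shows "(\<lambda>n. \<sigma> n * ((1 + C * exp (\<sigma> n) powr - s) powr (1 / \<beta>) *
     (1 + A * ((1 / (real n * c * b n)) powr s * (exp (\<sigma> n) + 1 / (real n * c * b n))) + A' * (1 / (c\<^sup>2 * real n * b n))) *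
     (1 + C' / ln (real n)) - 1)) \<longlonglongrightarrow> 0"
proof -
  define e1 where "e1 n = (1 + C * exp (\<sigma> n) powr - s) powr (1 / \<beta>) - 1" for n
  define e2 where "e2 n = (1 / (real n * c * b n)) powr s * (exp (\<sigma> n) + 1 / (real n * c * b n))" for n
  define e3 where "e3 n = 1 / (c\<^sup>2 * real n * b n)" for n
  define e4 where "e4 n = C' / ln (real n)" for n :: nat
  have l1: "(\<lambda>n. \<sigma> n * e1 n) \<longlonglongrightarrow> 0" "e1 \<longlonglongrightarrow> 0"
    unfolding \<sigma>_def e1_def[abs_def] using assms(1-3) by real_asymp+
  have l3: "(\<lambda>n. \<sigma> n * e3 n) \<longlonglongrightarrow> 0" "e3 \<longlonglongrightarrow> 0"
    unfolding \<sigma>_def e3_def[abs_def] b_def using q \<kappa> c by real_asymp+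
  have l4: "(\<lambda>n. \<sigma> n * e4 n) \<longlonglongrightarrow> 0" "e4 \<longlonglongrightarrow> 0"
    unfolding \<sigma>_def e4_def[abs_def] by real_asymp+
  define \<tau> where "\<tau> = (1 - \<kappa>) / 2"
  have \<tau>: "\<tau> > 0" using \<kappa> by (simp add: \<tau>_def)
  have y: "\<forall>\<^sub>F n in sequentially. 1 / (real n * c * b n) \<le> real n powr - \<tau>"
  proof -
    have "\<forall>\<^sub>F n in sequentially. 1 / (c * q) \<le> real n powr \<tau>" "\<forall>\<^sub>F n::nat in sequentially. ln (real n) \<ge> 1"
      using \<tau> by real_asymp+
    then show ?thesis using eventually_gt_at_top[of 1]
    proof eventually_elim
      case (elim n)
      have "real n powr \<tau> * real n powr \<tau> = real n * (1 / real n) powr \<kappa>"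
        using elim by (simp add: powr_divide powr_add[symmetric] \<tau>_def powr_diff)
      also have "\<dots> \<le> real n * (ln (real n) / real n) powr \<kappa>"
        using elim \<kappa> by (intro mult_left_mono powr_mono2 divide_right_mono) auto
      finally have "c * q * (real n powr \<tau> * real n powr \<tau>) \<le> c * q * (real n * (ln (real n) / real n) powr \<kappa>)"
        using c q by (intro mult_left_mono) auto
      then have "c * q * real n powr \<tau> * real n powr \<tau> \<le> real n * c * b n"
        by (simp add: b_def mult_ac)
      moreover have "1 \<le> c * q * real n powr \<tau>" using elim c q by (simp add: field_simps)
      then have "1 * real n powr \<tau> \<le> c * q * real n powr \<tau> * real n powr \<tau>"
        by (rule mult_right_mono) auto
      ultimately have "real n powr \<tau> \<le> real n * c * b n" by simp
      then have "1 / (real n * c * b n) \<le> 1 / real n powr \<tau>" using elim c q by (intro divide_left_mono mult_pos_pos) (auto simp: b_def)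
      then show ?case by (simp add: powr_minus divide_inverse)
    qed
  qed
  have dom: "(\<lambda>n. \<sigma> n * ((real n powr - \<tau>) powr s * (exp (\<sigma> n) + real n powr - \<tau>))) \<longlonglongrightarrow> 0"
    unfolding \<sigma>_def using \<tau> assms(2) by real_asymp
  have l2: "(\<lambda>n. \<sigma> n * e2 n) \<longlonglongrightarrow> 0"
  proof (rule tendsto_sandwich[OF _ _ tendsto_const dom])
    show "\<forall>\<^sub>F n in sequentially. 0 \<le> \<sigma> n * e2 n"
      using eventually_gt_at_top[of 1]
      by eventually_elim (use q c in \<open>auto simp: \<sigma>_def e2_def b_def intro!: mult_nonneg_nonneg add_nonneg_nonneg divide_nonneg_nonneg\<close>)
    show "\<forall>\<^sub>F n in sequentially. \<sigma> n * e2 n \<le> \<sigma> n * ((real n powr - \<tau>) powr s * (exp (\<sigma> n) + real n powr - \<tau>))"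
      using eventually_gt_at_top[of 1] y
    proof eventually_elim
      case (elim n)
      have "0 \<le> 1 / (real n * c * b n)" using q c by (simp add: b_def)
      then show ?case unfolding e2_def using elim assms(2)
        by (intro mult_left_mono mult_mono powr_mono2 add_mono) (auto simp: \<sigma>_def)
    qed
  qed
  have eq: "\<sigma> n * ((1 + e1 n) * (1 + A * e2 n + A' * e3 n) * (1 + e4 n) - 1)
     = (\<sigma> n * e1 n) * (1 + e4 n) + (1 + e1 n) * (1 + e4 n) * (A * (\<sigma> n * e2 n) + A' * (\<sigma> n * e3 n)) + \<sigma> n * e4 n" for n
    by (simp add: algebra_simps)
  have "(\<lambda>n. (\<sigma> n * e1 n) * (1 + e4 n) + (1 + e1 n) * (1 + e4 n) * (A * (\<sigma> n * e2 n) + A' * (\<sigma> n * e3 n)) + \<sigma> n * e4 n)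
     \<longlonglongrightarrow> 0 * (1 + 0) + (1 + 0) * (1 + 0) * (A * 0 + A' * 0) + 0"
    by (intro tendsto_intros l1 l2 l3 l4)
  then show ?thesis
    unfolding eq[symmetric] by (simp add: e1_def e2_def e3_def e4_def)
qed

text \<open>
  A cutoff at \<open>exp (sqrt (ln n))\<close> lowers the logarithm of the number of disjoint bumps by a multiple of
  \<open>sqrt (ln n)\<close> only.
\<close>

lemma number_of_bumps_large:
  fixes q l \<kappa> :: real assumes "q > 0" "l > 0" "0 < \<kappa>" "\<kappa> < 1"
  shows "\<forall>\<^sub>F n::nat in sequentially. exp (\<kappa> * ln (real n) - 2 * sqrt (ln (real n)))
     \<le> l / (2 * (q * (ln (real n) / real n) powr \<kappa>) * exp (sqrt (ln (real n)))) - 1"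
  using assms by real_asymp

text \<open>
  For shifts of the size of the bumps this turns the bound \<open>1 / ln (1 / \<bar>\<theta>\<bar>)\<close> for the
  remainder of the moment expansion into \<open>1 / ln n\<close>.
\<close>

lemma log_inverse_amplitude_large:
  fixes q \<kappa> :: real assumes "q > 0" "0 < \<kappa>"
  shows "\<forall>\<^sub>F n::nat in sequentially. \<kappa> / 2 * ln (real n) \<le> ln (1 / (q * (ln (real n) / real n) powr \<kappa>))"
  using assms by real_asymp

lemma amplitude_tendsto_0:
  fixes q \<kappa> :: real assumes "q > 0" "0 < \<kappa>"
  shows "(\<lambda>n::nat. (q * (ln (real n) / real n) powr \<kappa>)) \<longlonglongrightarrow> 0"
  using assms by real_asymp

section \<open>Undetectable bumps\<close>

text \<open>
  The bumps \<^term>\<open>\<lambda>x. a * g ((x - t) / b)\<close>, with centres \<^term>\<open>t\<close> at distances \<open>2 * b * K\<close>, have disjoint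
  supports. Dividing by \<open>sqrt h\<close> gives regression functions \<open>l j\<close> whose values at the design points are the shifts
  of the errors. By the moment condition the likelihood ratio of the \<open>j\<close>th one has a moment of order \<open>1 + \<delta>\<close> of at most
  \<^term>\<open>exp (w * S)\<close>, where \<^term>\<open>S\<close> bounds the sum of the squared shifts.
\<close>

lemma exists_undetectable_bump:
  fixes \<epsilon> :: "nat \<Rightarrow> 'a \<Rightarrow> real"
  assumes hpos: "\<And>x. x \<in> {0..1} \<Longrightarrow> h x > (0::real)" and hc: "continuous_on {0..1} h"
    and h1: "(LINT x:{0..1}|lborel. h x) = 1" and n: "n \<ge> 1"
    and V: "\<And>m t. (\<forall>i\<le>m. t i \<in> {0..1}) \<Longrightarrow> mono_on {..m::nat} t \<Longrightarrow> (\<Sum>i<m. \<bar>h (t (Suc i)) - h (t i)\<bar>) \<le> V"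
    and c: "c > 0" "\<And>x. x \<in> {0..1} \<Longrightarrow> h x \<ge> c"
    and gH: "g \<in> holder_class \<beta> H UNIV" "g 0 \<ge> 1"
    and g: "\<And>x. \<bar>g x\<bar> \<le> B" "\<And>x y. \<bar>g x - g y\<bar> \<le> B * \<bar>x - y\<bar> powr s" "0 < s"
    and supp: "\<And>x. \<bar>x\<bar> \<ge> K \<Longrightarrow> g x = 0" and K: "K \<ge> 0"
    and g2: "integrable lborel (\<lambda>x. (g x)\<^sup>2)" "(LINT x|lborel. (g x)\<^sup>2) \<le> \<Gamma>"
    and ab: "a \<ge> 0" "b > 0" and aH: "a * H \<le> L * b powr \<beta>"
    and J: "is_interval J" "J \<subseteq> {0..1}" "p \<in> J" "q \<in> J"
    and m: "m > 0" "2 * b * K * real m \<le> q - p"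
    and M: "prob_space M" and ind: "prob_space.indep_vars M (\<lambda>_. borel) \<epsilon> {1..n}"
    and dist: "\<And>i. i \<in> {1..n} \<Longrightarrow> distributed M lborel (\<epsilon> i) (\<lambda>x. ennreal (f x))"
    and fpos: "\<And>x. f x > 0" and \<phi>: "is_test n \<phi>"
    and \<delta>: "0 < \<delta>" "\<delta> \<le> 1" and w: "w \<ge> 0"
    and moment: "\<And>\<theta>. \<theta> \<noteq> 0 \<Longrightarrow> \<bar>\<theta>\<bar> \<le> a * B / sqrt c \<Longrightarrow>
       integrable lborel (\<lambda>z. ((f (z + \<theta>) / f z) powr (1 + \<delta>) - 1) * f z) \<and>
       (LINT z|lborel. ((f (z + \<theta>) / f z) powr (1 + \<delta>) - 1) * f z) \<le> w * \<theta>\<^sup>2"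
    and S: "real n * a\<^sup>2 * b * (\<Gamma> + 4 * B\<^sup>2 * (1 / (real n * c * b)) powr s * (K + 1 / (real n * c * b)) + B\<^sup>2 * V / (c\<^sup>2 * real n * b)) \<le> S"
  shows "\<exists>l \<in> weighted_holder_class h \<beta> L. sup_norm_on J (\<lambda>x. l x * sqrt (h x)) \<ge> a \<and>
     expectation_under M h \<epsilon> n l \<phi> \<le> expectation_under M h \<epsilon> n (\<lambda>_. 0) \<phi>
       + sqrt (real m powr - \<delta> * exp (w * S)) + real m powr - \<delta> * exp (w * S)"
proof -
  interpret prob_space M by (rule M)
  define X where "X i = design_point h n i" for i
  define t where "t j = p + 2 * b * K * real j" for j :: nat
  define l where "l j x = a * g ((x - t j) / b) / sqrt (h x)" for j x
  define \<theta> where "\<theta> j i = l j (X i)" for j i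
  have X01: "X i \<in> {0..1}" if "i \<in> {1..n}" for i
    using design_point_props(1)[OF hpos hc h1 n, of i] that by (simp add: X_def)
  have B0: "B \<ge> 0" using g(1)[of 0] by auto
  have lmem: "l j \<in> weighted_holder_class h \<beta> L" for j
  proof -
    have "(\<lambda>x. a * g ((x - t j) / b)) \<in> holder_class \<beta> L {0..1}"
      by (rule holder_class_rescale[OF gH(1) ab aH])
    then show ?thesis
      unfolding weighted_holder_class_def by (auto simp: l_def[abs_def] intro!: exI[of _ "\<lambda>x. a * g ((x - t j) / b)"])
  qed
  have tJ: "t j \<in> J" if "j < m" for j
  proof -
    have "2 * b * K * real j \<le> 2 * b * K * real m" using that ab K by (intro mult_left_mono) auto
    moreover have "0 \<le> 2 * b * K * real j" using ab K by simp
    ultimately have "p \<le> t j" "t j \<le> q" using m(2) unfolding t_def by linarith+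
    then show ?thesis using J(1,3,4) unfolding is_interval_1 by blast
  qed
  have lh: "l j x * sqrt (h x) = a * g ((x - t j) / b)" if "x \<in> {0..1}" for j x
    using hpos[OF that] by (simp add: l_def)
  have norm: "sup_norm_on J (\<lambda>x. l j x * sqrt (h x)) \<ge> a" if j: "j < m" for j
  proof -
    have "a \<le> a * g 0" using gH(2) ab by (simp add: mult_left_le_one_le mult_le_cancel_left1)
    also have "\<dots> \<le> \<bar>l j (t j) * sqrt (h (t j))\<bar>" using lh[of "t j" j] tJ[OF j] J(2) by auto
    also have "\<dots> \<le> sup_norm_on J (\<lambda>x. l j x * sqrt (h x))"
      unfolding sup_norm_on_def
    proof (rule cSUP_upper[OF tJ[OF j]])
      show "bdd_above ((\<lambda>x. \<bar>l j x * sqrt (h x)\<bar>) ` J)"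
      proof (rule bdd_aboveI2)
        fix x assume "x \<in> J"
        then have "x \<in> {0..1}" using J(2) by blast
        from lh[OF this, of j] have "\<bar>l j x * sqrt (h x)\<bar> = a * \<bar>g ((x - t j) / b)\<bar>"
          using ab by (simp only: abs_mult abs_of_nonneg)
        then show "\<bar>l j x * sqrt (h x)\<bar> \<le> a * B" using g(1) ab by (simp add: mult_left_mono)
      qed
    qed
    finally show ?thesis .
  qed
  have \<theta>small: "\<bar>\<theta> j i\<bar> \<le> a * B / sqrt c" if i: "i \<in> {1..n}" for i j
  proof -
    have "\<bar>\<theta> j i\<bar> = a * \<bar>g ((X i - t j) / b)\<bar> / sqrt (h (X i))"
      using hpos[OF X01[OF i]] ab by (simp add: \<theta>_def l_def abs_mult)
    also have "\<dots> \<le> a * B / sqrt c"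
      using g(1) ab c(1) c(2)[OF X01[OF i]] B0 by (intro frac_le mult_mono) auto
    finally show ?thesis .
  qed
  have disj: "\<theta> j i = 0 \<or> \<theta> k i = 0" if "j < m" "k < m" "j \<noteq> k" for j k i
  proof (rule ccontr)
    have near: "\<bar>X i - t j\<bar> < b * K" if "\<theta> j i \<noteq> 0" for j
    proof -
      have "g ((X i - t j) / b) \<noteq> 0" using that by (auto simp: \<theta>_def l_def)
      then have "\<bar>(X i - t j) / b\<bar> < K" using supp by force
      then show ?thesis using ab by (simp add: field_simps)
    qed
    assume "\<not> ?thesis"
    then have "\<bar>t j - t k\<bar> < 2 * b * K" using near[of j] near[of k] by auto
    moreover have "t j - t k = 2 * b * K * (real j - real k)" by (simp add: t_def algebra_simps)
    moreover have "\<bar>real j - real k\<bar> \<ge> 1" using that(3) by linarith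
    ultimately show False
      using mult_left_mono[of 1 "\<bar>real j - real k\<bar>" "2 * b * K"] ab K by (simp add: abs_mult)
  qed
  have sumsq: "(\<Sum>i\<in>{1..n}. (\<theta> j i)\<^sup>2) \<le> S" for j
  proof -
    have "(\<theta> j i)\<^sup>2 = (a * g ((X i - t j) / b))\<^sup>2 / h (X i)" if "i \<in> {1..n}" for i
      using hpos[OF X01[OF that]] by (simp add: \<theta>_def l_def power_divide)
    then have "(\<Sum>i\<in>{1..n}. (\<theta> j i)\<^sup>2) = (\<Sum>i\<in>{1..n}. (a * g ((X i - t j) / b))\<^sup>2 / h (X i))"
      by (intro sum.cong) auto
    also have "\<dots> \<le> S"
      unfolding X_def by (rule order_trans[OF design_sum_bump_le[OF hpos hc h1 n V c g supp K g2 ab] S])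
    finally show ?thesis .
  qed
  have one: "1 \<in> {1..n}" using n by simp
  have fint: "integrable lborel f" "(LINT z|lborel. f z) = 1"
  proof -
    show "integrable lborel f"
      using distributed_integrable[OF dist[OF one], of "\<lambda>_. 1"] fpos by (simp add: less_imp_le)
    show "(LINT z|lborel. f z) = 1"
      using distributed_integral[OF dist[OF one], of "\<lambda>_. 1"] fpos by (simp add: less_imp_le prob_space)
  qed
  have factor: "integrable lborel (\<lambda>z. (f (z - u) / f z) powr (1 + \<delta>) * f z)"
       "(LINT z|lborel. (f (z - u) / f z) powr (1 + \<delta>) * f z) \<le> exp (w * u\<^sup>2)"
    if u: "\<bar>u\<bar> \<le> a * B / sqrt c" for u
  proof -
    have "integrable lborel (\<lambda>z. (f (z - u) / f z) powr (1 + \<delta>) * f z) \<and>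
       (LINT z|lborel. (f (z - u) / f z) powr (1 + \<delta>) * f z) \<le> exp (w * u\<^sup>2)"
    proof (cases "u = 0")
      case True
      have "f z / f z = 1" for z using fpos[of z] by simp
      then show ?thesis using True fint by simp
    next
      case False
      have eq: "(f (z - u) / f z) powr (1 + \<delta>) * f z = ((f (z + - u) / f z) powr (1 + \<delta>) - 1) * f z + f z" for z
        by (simp add: algebra_simps)
      have mo: "integrable lborel (\<lambda>z. ((f (z + - u) / f z) powr (1 + \<delta>) - 1) * f z)"
        "(LINT z|lborel. ((f (z + - u) / f z) powr (1 + \<delta>) - 1) * f z) \<le> w * (- u)\<^sup>2"
        using moment[of "- u"] u False by auto
      have "(LINT z|lborel. (f (z - u) / f z) powr (1 + \<delta>) * f z)
          = (LINT z|lborel. ((f (z + - u) / f z) powr (1 + \<delta>) - 1) * f z) + 1"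
        unfolding eq by (subst Bochner_Integration.integral_add[OF mo(1) fint(1)]) (simp add: fint(2))
      also have "\<dots> \<le> 1 + w * u\<^sup>2" using mo(2) by simp
      also have "\<dots> \<le> exp (w * u\<^sup>2)" by (rule exp_ge_add_one_self)
      finally show ?thesis
        unfolding eq using Bochner_Integration.integrable_add[OF mo(1) fint(1)] by blast
    qed
    then show "integrable lborel (\<lambda>z. (f (z - u) / f z) powr (1 + \<delta>) * f z)"
       "(LINT z|lborel. (f (z - u) / f z) powr (1 + \<delta>) * f z) \<le> exp (w * u\<^sup>2)" by auto
  qed
  have "\<exists>j<m. (LINT \<omega>|M. \<phi> (\<lambda>i\<in>{1..n}. \<theta> j i + \<epsilon> i \<omega>)) \<le> (LINT \<omega>|M. \<phi> (\<lambda>i\<in>{1..n}. \<epsilon> i \<omega>))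
           + sqrt (real m powr - \<delta> * exp (w * S)) + real m powr - \<delta> * exp (w * S)"
  proof (rule exists_undetectable_shift[OF _ _ ind dist fpos _ _ m(1) disj \<delta> factor(1)[OF \<theta>small]])
    show "{1..n} \<noteq> {}" using n by auto
    show "\<phi> \<in> borel_measurable (\<Pi>\<^sub>M i\<in>{1..n}. borel)" using \<phi> unfolding is_test_def by blast
    show "0 \<le> \<phi> y \<and> \<phi> y \<le> 1" if "y \<in> space (\<Pi>\<^sub>M i\<in>{1..n}. (borel :: real measure))" for y
      using \<phi> that unfolding is_test_def by blast
    show "(\<Prod>i\<in>{1..n}. LINT z|lborel. (f (z - \<theta> j i) / f z) powr (1 + \<delta>) * f z) \<le> exp (w * S)" for j
    proof -
      have "(\<Prod>i\<in>{1..n}. LINT z|lborel. (f (z - \<theta> j i) / f z) powr (1 + \<delta>) * f z)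
          \<le> (\<Prod>i\<in>{1..n}. exp (w * (\<theta> j i)\<^sup>2))"
        by (intro prod_mono conjI factor(2) \<theta>small Bochner_Integration.integral_nonneg)
           (use fpos in \<open>auto simp: less_imp_le\<close>)
      also have "\<dots> = exp (w * (\<Sum>i\<in>{1..n}. (\<theta> j i)\<^sup>2))"
        by (simp add: exp_sum sum_distrib_left)
      also have "\<dots> \<le> exp (w * S)" using sumsq w by (simp add: mult_left_mono)
      finally show ?thesis .
    qed
  qed auto
  then obtain j where j: "j < m" and
    le: "(LINT \<omega>|M. \<phi> (\<lambda>i\<in>{1..n}. \<theta> j i + \<epsilon> i \<omega>)) \<le> (LINT \<omega>|M. \<phi> (\<lambda>i\<in>{1..n}. \<epsilon> i \<omega>))
           + sqrt (real m powr - \<delta> * exp (w * S)) + real m powr - \<delta> * exp (w * S)" by blast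
  have "expectation_under M h \<epsilon> n (l j) \<phi> = (LINT \<omega>|M. \<phi> (\<lambda>i\<in>{1..n}. \<theta> j i + \<epsilon> i \<omega>))"
    by (simp add: expectation_under_def sample_def[abs_def] \<theta>_def X_def)
  moreover have "expectation_under M h \<epsilon> n (\<lambda>_. 0) \<phi> = (LINT \<omega>|M. \<phi> (\<lambda>i\<in>{1..n}. \<epsilon> i \<omega>))"
    by (simp add: expectation_under_def sample_def[abs_def])
  ultimately show ?thesis using lmem norm[OF j] le by (intro bexI[of _ "l j"]) auto
qed

text \<open>
  This computation determines the constant \<open>d\<close>: without the powers of \<open>1 - e\<close> and \<open>H\<close>, half the Fisher
  information times the signal energy is \<open>ln n / (2 * \<beta> + 1)\<close>, the logarithm of the number of bumps to first order.
\<close>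

lemma signal_energy_eq:
  fixes \<beta> L I \<Gamma> e H x :: real
  assumes pos: "\<beta> > 0" "L > 0" "I > 0" "\<Gamma> > 0" "0 < e" "e < 1" "H > 0" "x > 0" "ln x > 0"
  defines "d \<equiv> (2 * L powr (1 / \<beta>) / ((2 * \<beta> + 1) * I * \<Gamma>)) powr (\<beta> / (2 * \<beta> + 1))"
  defines "a \<equiv> (1 - e) * d * (ln x / x) powr (\<beta> / (2 * \<beta> + 1))"
  shows "I / 2 * (x * a\<^sup>2 * (a * H / L) powr (1 / \<beta>) * \<Gamma>)
       = (1 - e) powr (2 + 1 / \<beta>) * H powr (1 / \<beta>) * (ln x / (2 * \<beta> + 1))"
proof -
  have dpos: "d > 0" using pos by (simp add: d_def)
  have apos: "a > 0" using pos dpos by (simp add: a_def)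
  have ex: "\<beta> / (2 * \<beta> + 1) * (2 + 1 / \<beta>) = 1"
  proof -
    have "2 + 1 / \<beta> = (2 * \<beta> + 1) / \<beta>" using pos by (simp add: field_simps)
    then show ?thesis using pos by simp
  qed
  have cancel: "(y powr (\<beta> / (2 * \<beta> + 1))) powr (2 + 1 / \<beta>) = y" if "y > 0" for y
    using that by (simp only: powr_powr ex powr_one)
  have "a powr (2 + 1 / \<beta>) = (1 - e) powr (2 + 1 / \<beta>) * d powr (2 + 1 / \<beta>) * ((ln x / x) powr (\<beta> / (2 * \<beta> + 1))) powr (2 + 1 / \<beta>)"
    by (simp only: a_def powr_mult)
  also have "d powr (2 + 1 / \<beta>) = 2 * L powr (1 / \<beta>) / ((2 * \<beta> + 1) * I * \<Gamma>)"
    unfolding d_def by (rule cancel) (use pos in simp)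
  also have "((ln x / x) powr (\<beta> / (2 * \<beta> + 1))) powr (2 + 1 / \<beta>) = ln x / x"
    by (rule cancel) (use pos in simp)
  finally have A: "a powr (2 + 1 / \<beta>) = (1 - e) powr (2 + 1 / \<beta>) * (2 * L powr (1 / \<beta>) / ((2 * \<beta> + 1) * I * \<Gamma>)) * (ln x / x)" .
  have "a\<^sup>2 * (a * H / L) powr (1 / \<beta>) = a powr (2 + 1 / \<beta>) * (H powr (1 / \<beta>) / L powr (1 / \<beta>))"
    using apos pos by (simp add: powr_add powr_mult powr_divide)
  then have "I / 2 * (x * a\<^sup>2 * (a * H / L) powr (1 / \<beta>) * \<Gamma>)
     = I / 2 * x * \<Gamma> * (a powr (2 + 1 / \<beta>) * (H powr (1 / \<beta>) / L powr (1 / \<beta>)))"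
    by (simp add: mult_ac)
  also have "\<dots> = (1 - e) powr (2 + 1 / \<beta>) * H powr (1 / \<beta>) * (ln x / (2 * \<beta> + 1))"
    unfolding A using pos by (simp add: divide_simps)
  finally show ?thesis .
qed

text \<open>
  With \<open>\<sigma> = sqrt (ln n)\<close> and \<open>e = \<epsilon>\<^sub>n\<close>. The number \<^term>\<open>m\<close> of bumps beats the moment of the
  likelihood ratios because the amplitude was lowered by the factor \<open>1 - e\<close>; the choice \<open>\<delta> = e / 2\<close> uses up
  half of this gain. The remaining half, of order \<open>e * \<sigma>\<^sup>2\<close>, dominates the loss \<open>2 * \<sigma>\<close> from the cutoff exactly
  when \<open>\<sigma> * e\<close> is large, which is the growth condition on \<open>\<epsilon>\<^sub>n\<close>.
\<close>

lemma likelihood_moment_negligible: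
  fixes e \<kappa> \<sigma> \<tau> :: real and m :: nat
  assumes e: "0 < e" "e \<le> 1" and \<kappa>: "\<kappa> > 0" and \<sigma>: "\<sigma> > 0"
    and m: "exp (\<kappa> * \<sigma>\<^sup>2 - 2 * \<sigma>) \<le> real m"
    and \<tau>: "\<tau> \<le> e / 2 * (1 + e / 2) * ((1 - e) * (\<kappa> * \<sigma>\<^sup>2))"
  shows "real m powr - (e / 2) * exp \<tau> \<le> exp (- (\<sigma> * e / 2) * (\<sigma> * e * \<kappa> / 2 - 2))"
proof -
  have mpos: "real m > 0" using m exp_gt_zero order_less_le_trans by blast
  have "\<kappa> * \<sigma>\<^sup>2 - 2 * \<sigma> \<le> ln (real m)" using m mpos by (simp add: ln_ge_iff)
  then have lnm: "e / 2 * (\<kappa> * \<sigma>\<^sup>2 - 2 * \<sigma>) \<le> e / 2 * ln (real m)" using e by (intro mult_left_mono) auto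
  have "(1 + e / 2) * (1 - e) \<le> 1 - e / 2" using e by (simp add: algebra_simps)
  then have "(1 + e / 2) * (1 - e) * (e / 2 * (\<kappa> * \<sigma>\<^sup>2)) \<le> (1 - e / 2) * (e / 2 * (\<kappa> * \<sigma>\<^sup>2))"
    using e \<kappa> by (intro mult_right_mono) auto
  then have "\<tau> \<le> (1 - e / 2) * (e / 2 * (\<kappa> * \<sigma>\<^sup>2))" using \<tau> by (simp add: mult_ac)
  then have "- (e / 2) * ln (real m) + \<tau> \<le> - (e / 2 * (\<kappa> * \<sigma>\<^sup>2 - 2 * \<sigma>)) + (1 - e / 2) * (e / 2 * (\<kappa> * \<sigma>\<^sup>2))"
    using lnm by (simp only: mult_minus_left)
  also have "\<dots> = - (\<sigma> * e / 2) * (\<sigma> * e * \<kappa> / 2 - 2)" by (simp add: field_simps power2_eq_square)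
  finally have "exp (- (e / 2) * ln (real m) + \<tau>) \<le> exp (- (\<sigma> * e / 2) * (\<sigma> * e * \<kappa> / 2 - 2))"
    by (simp only: exp_le_cancel_iff)
  moreover have "real m powr - (e / 2) * exp \<tau> = exp (- (e / 2) * ln (real m) + \<tau>)"
    unfolding exp_add using mpos by (simp add: powr_def)
  ultimately show ?thesis by (simp only:)
qed

section \<open>The lower bound\<close>

theorem theorem2:
  fixes \<beta> L \<alpha> \<delta>\<^sub>0 :: real
    and h f \<gamma> :: "real \<Rightarrow> real"
    and r :: "real \<Rightarrow> real \<Rightarrow> real"
    and M :: "nat \<Rightarrow> 'a measure"
    and \<epsilon> :: "nat \<Rightarrow> nat \<Rightarrow> 'a \<Rightarrow> real"
    and eps :: "nat \<Rightarrow> real"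
    and J :: "real set"
    and \<phi> :: "nat \<Rightarrow> (nat \<Rightarrow> real) \<Rightarrow> real"
  assumes "\<beta> > 0" and "L > 0" and "0 < \<alpha>" and "\<alpha> < 1"
    and gamma: "minimal_norm_solution \<beta> \<gamma>"
    \<comment> \<open>the errors of the \<open>n\<close>th experiment are i.i.d. with symmetric Lebesgue density \<open>f\<close>\<close>
    and "\<And>n. n \<ge> 1 \<Longrightarrow> prob_space (M n)"
    and "\<And>n. n \<ge> 1 \<Longrightarrow> prob_space.indep_vars (M n) (\<lambda>_. borel) (\<epsilon> n) {1..n}"
    and "\<And>n i. n \<ge> 1 \<Longrightarrow> i \<in> {1..n} \<Longrightarrow> distributed (M n) lborel (\<epsilon> n i) (\<lambda>x. ennreal (f x))"
    and "\<And>x. f (- x) = f x"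
    \<comment> \<open>(i)\<close>
    and "\<And>x. x \<in> {0..1} \<Longrightarrow> h x > 0" and "continuous_on {0..1} h"
    and "(LINT x:{0..1}|lborel. h x) = 1"
    and "finite_total_variation_on {0..1} h"
    \<comment> \<open>(ii)\<close>
    and "\<And>x. f x > 0" and "\<And>a b. abs_continuous_on {a..b} f"
    and "integrable lborel (fisher_integrand f)"
    \<comment> \<open>(iii)\<close>
    and "\<delta>\<^sub>0 > 0"
    and "\<forall>\<^sub>F \<theta> in at 0. \<forall>\<delta>\<in>{0<..\<delta>\<^sub>0}.
           integrable lborel (\<lambda>z. ((f (z + \<theta>) / f z) powr (1 + \<delta>) - 1) * f z) \<and>
           (LINT z|lborel. ((f (z + \<theta>) / f z) powr (1 + \<delta>) - 1) * f z)
             = 1 / 2 * \<delta> * (1 + \<delta>) * \<theta>\<^sup>2 * fisher_information f * (1 + r \<theta> \<delta>)"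
    and "\<exists>C. \<forall>\<^sub>F \<theta> in at 0. \<forall>\<delta>\<in>{0<..\<delta>\<^sub>0}. \<bar>r \<theta> \<delta>\<bar> \<le> C * (1 / ln (1 / \<bar>\<theta>\<bar>))"
    \<comment> \<open>the sequence, the interval and the tests\<close>
    and "\<And>n. n \<ge> 1 \<Longrightarrow> eps n > 0" and "eps \<longlonglongrightarrow> 0"
    and "filterlim (\<lambda>n. sqrt (ln (real n)) * eps n) at_top sequentially"
    and "is_interval J" and "J \<subseteq> {0..1}" and "\<exists>a\<in>J. \<exists>b\<in>J. a < b"
    and "\<And>n. n \<ge> 1 \<Longrightarrow> is_test n (\<phi> n)"
    and "\<And>n. n \<ge> 1 \<Longrightarrow> expectation_under (M n) h (\<epsilon> n) n (\<lambda>_. 0) (\<phi> n) \<le> \<alpha>"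
  shows "limsup (\<lambda>n. INF l \<in> {l \<in> weighted_holder_class h \<beta> L.
             sup_norm_on J (\<lambda>x. l x * sqrt (h x)) \<ge> (1 - eps n) * d_star \<beta> L f \<gamma> * rate \<beta> n}.
           ereal (expectation_under (M n) h (\<epsilon> n) n l (\<phi> n))) \<le> ereal \<alpha>"
proof -
  note \<beta> = \<open>\<beta> > 0\<close> and L = \<open>L > 0\<close>
  note prob = assms(6) and ind = assms(7) and dist = assms(8)
  note hpos = assms(10) and hc = assms(11) and h1 = assms(12) and tv = assms(13)
  note fpos = assms(14) and \<delta>0 = assms(17) and mom = assms(18) and rbound = assms(19)
  note eps_pos = assms(20) and eps0 = assms(21) and eps_log = assms(22)
  note J = assms(23,24) and J2 = assms(25) and test = assms(26) and level = assms(27)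
  have \<gamma>: "\<gamma> \<in> holder_class \<beta> 1 UNIV" "\<gamma> 0 \<ge> 1" and \<gamma>int: "integrable lborel (\<lambda>x. (\<gamma> x)\<^sup>2)"
    using gamma by (auto simp: minimal_norm_solution_def)
  obtain p q where pq: "p \<in> J" "q \<in> J" "p < q" using J2 by blast
  define I where "I = fisher_information f"
  define \<Gamma> where "\<Gamma> = (LINT x|lborel. (\<gamma> x)\<^sup>2)"
  define d where "d = d_star \<beta> L f \<gamma>"
  define \<kappa> where "\<kappa> = 1 / (2 * \<beta> + 1)"
  define \<sigma> where "\<sigma> n = sqrt (ln (real n))" for n :: nat
  define err where "err n = exp (- (\<sigma> n * eps n / 2) * (\<sigma> n * eps n * \<kappa> / 2 - 2))" for n
  have \<kappa>: "0 < \<kappa>" "\<kappa> < 1" using \<beta> by (auto simp: \<kappa>_def)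
  have \<beta>\<kappa>: "\<beta> / (2 * \<beta> + 1) = \<beta> * \<kappa>" by (simp add: \<kappa>_def)
  have I0: "I \<ge> 0" unfolding I_def fisher_information_def fisher_integrand_def
    using fpos by (intro Bochner_Integration.integral_nonneg) (simp add: less_imp_le)
  have \<Gamma>0: "\<Gamma> \<ge> 0" unfolding \<Gamma>_def by (intro Bochner_Integration.integral_nonneg) auto
  have dI: "d = (2 * L powr (1 / \<beta>) / ((2 * \<beta> + 1) * I * \<Gamma>)) powr (\<beta> / (2 * \<beta> + 1))"
    using \<Gamma>0 by (simp add: d_def d_star_def I_def L2_norm_def \<Gamma>_def)
  define alternatives where "alternatives n = {l \<in> weighted_holder_class h \<beta> L.
             sup_norm_on J (\<lambda>x. l x * sqrt (h x)) \<ge> (1 - eps n) * d * rate \<beta> n}" for n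
  have main: "\<forall>\<^sub>F n in sequentially. \<exists>l \<in> alternatives n.
      expectation_under (M n) h (\<epsilon> n) n l (\<phi> n) \<le> \<alpha> + sqrt (err n) + err n"
  (* If d is 0, which by the conventions for division includes a vanishing Fisher information or norm,
     the zero function is an admissible alternative; otherwise both are positive. *)
  proof (cases "d = 0")
    case True
    have "(\<lambda>x. 0 * \<gamma> ((x - 0) / 1)) \<in> holder_class \<beta> L {0..1}"
      by (rule holder_class_rescale[OF \<gamma>(1)]) (use L in auto)
    then have zero: "(\<lambda>x. 0) \<in> weighted_holder_class h \<beta> L"
      unfolding weighted_holder_class_def by (auto intro!: exI[of _ "\<lambda>x. 0"])
    have "J \<noteq> {}" using pq by auto
    then have "sup_norm_on J (\<lambda>x. 0 * sqrt (h x)) = 0"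
      unfolding sup_norm_on_def by (simp add: cSUP_const)
    then have mem: "(\<lambda>x. 0) \<in> alternatives n" for n using zero True by (simp add: alternatives_def)
    show ?thesis
      using eventually_ge_at_top[of 1]
    proof eventually_elim
      case (elim n)
      have "err n \<ge> 0" by (simp add: err_def)
      then have "0 \<le> sqrt (err n) + err n" by simp
      then show ?case using level[OF elim] mem[of n] by (intro bexI[of _ "\<lambda>x. 0"]) auto
    qed
  next
    case False
    then have base: "2 * L powr (1 / \<beta>) / ((2 * \<beta> + 1) * I * \<Gamma>) \<noteq> 0" unfolding dI by auto
    then have I: "I > 0" and \<Gamma>: "\<Gamma> > 0" using I0 \<Gamma>0 by auto
    have d: "d > 0" unfolding dI using base by simp
    obtain V where V: "\<And>m t. (\<forall>i\<le>m. t i \<in> {0..1}) \<Longrightarrow> mono_on {..m::nat} t \<Longrightarrow> (\<Sum>i<m. \<bar>h (t (Suc i)) - h (t i)\<bar>) \<le> V"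
      using tv unfolding finite_total_variation_on_def by blast
    have V0: "V \<ge> 0" using V[of 0 "\<lambda>_. 0"] by (simp add: mono_on_def)
    obtain x0 where x0: "x0 \<in> {0..1}" "\<forall>x\<in>{0..1}. h x0 \<le> h x"
      using continuous_attains_inf[OF compact_Icc _ hc] by auto
    define c where "c = h x0"
    have c: "c > 0" "\<And>x. x \<in> {0..1} \<Longrightarrow> h x \<ge> c" using x0 hpos by (auto simp: c_def)
    obtain C B s where C: "C \<ge> 0" and B: "B > 0" and s: "0 < s" "s \<le> 1" and
      trunc: "\<forall>K\<ge>1. \<exists>g. g \<in> holder_class \<beta> (1 + C * K powr - s) UNIV \<and>
        g 0 = \<gamma> 0 \<and> (\<forall>x. \<bar>g x\<bar> \<le> \<bar>\<gamma> x\<bar>) \<and> (\<forall>x. \<bar>g x\<bar> \<le> B) \<and> (\<forall>x. \<bar>x\<bar> \<ge> K \<longrightarrow> g x = 0) \<and>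
        (\<forall>x y. \<bar>g x - g y\<bar> \<le> B * \<bar>x - y\<bar> powr s)"
      using compactly_supported_competitor[OF \<beta> \<gamma>(1) \<gamma>int] by blast
    obtain Cr where "\<forall>\<^sub>F \<theta> in at 0. \<forall>\<delta>\<in>{0<..\<delta>\<^sub>0}. \<bar>r \<theta> \<delta>\<bar> \<le> Cr * (1 / ln (1 / \<bar>\<theta>\<bar>))"
      using rbound by blast
    from eventually_conj[OF mom this] obtain \<theta>0 where \<theta>0: "\<theta>0 > 0" and
      small: "\<And>\<theta> \<delta>. \<theta> \<noteq> 0 \<Longrightarrow> \<bar>\<theta>\<bar> < \<theta>0 \<Longrightarrow> \<delta> \<in> {0<..\<delta>\<^sub>0} \<Longrightarrow>
        integrable lborel (\<lambda>z. ((f (z + \<theta>) / f z) powr (1 + \<delta>) - 1) * f z) \<and>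
        (LINT z|lborel. ((f (z + \<theta>) / f z) powr (1 + \<delta>) - 1) * f z)
             = 1 / 2 * \<delta> * (1 + \<delta>) * \<theta>\<^sup>2 * I * (1 + r \<theta> \<delta>) \<and>
        \<bar>r \<theta> \<delta>\<bar> \<le> Cr * (1 / ln (1 / \<bar>\<theta>\<bar>))"
      unfolding eventually_at I_def by (auto simp: dist_real_def)
    define C' where "C' = \<bar>Cr\<bar> * 2 / (\<beta> * \<kappa>)"
    have C': "C' \<ge> 0" using \<beta> \<kappa> by (simp add: C'_def)
    define q1 where "q1 = (d / (2 * L)) powr (1 / \<beta>)"
    define q2 where "q2 = ((1 + C) * d / L) powr (1 / \<beta>)"
    define Q where "Q = d * B / sqrt c"
    have pos: "q1 > 0" "q2 > 0" "Q > 0" using d L C B c by (auto simp: q1_def q2_def Q_def add_pos_nonneg)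
    define A where "A = 4 * B\<^sup>2 / \<Gamma>"
    define A' where "A' = B\<^sup>2 * V / \<Gamma>"
    have A: "A \<ge> 0" "A' \<ge> 0" using \<Gamma> V0 by (auto simp: A_def A'_def)
    (* bl is a lower bound for the width of the bumps that does not involve the sequence eps. *)
    define bl where "bl n = q1 * (ln (real n) / real n) powr \<kappa>" for n :: nat
    define E where "E n = 1 + A * ((1 / (real n * c * bl n)) powr s * (exp (\<sigma> n) + 1 / (real n * c * bl n))) + A' * (1 / (c\<^sup>2 * real n * bl n))" for n
    have "(\<lambda>n. \<sigma> n * ((1 + C * exp (\<sigma> n) powr - s) powr (1 / \<beta>) * E n * (1 + C' / ln (real n)) - 1)) \<longlonglongrightarrow> 0"
      unfolding \<sigma>_def bl_def E_def by (rule bump_excess_negligible[OF C s(1) \<beta> pos(1) \<kappa> c(1)])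
    then have ev1: "\<forall>\<^sub>F n in sequentially. \<sigma> n * ((1 + C * exp (\<sigma> n) powr - s) powr (1 / \<beta>) * E n * (1 + C' / ln (real n)) - 1) < 1"
      by (rule order_tendstoD) simp
    have ev2: "\<forall>\<^sub>F n in sequentially. \<sigma> n * eps n \<ge> 1"
      using eps_log unfolding filterlim_at_top \<sigma>_def by blast
    have ev3: "\<forall>\<^sub>F n in sequentially. eps n < min (1 / 2) \<delta>\<^sub>0"
      by (rule order_tendstoD(2)[OF eps0]) (use \<delta>0 in auto)
    have ev4: "\<forall>\<^sub>F n in sequentially. exp (\<kappa> * ln (real n) - 2 * \<sigma> n)
       \<le> (q - p) / (2 * (q2 * (ln (real n) / real n) powr \<kappa>) * exp (\<sigma> n)) - 1"
      unfolding \<sigma>_def by (rule number_of_bumps_large) (use pos pq \<kappa> in auto)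
    have \<beta>\<kappa>0: "\<beta> * \<kappa> > 0" using \<beta> \<kappa> by simp
    have ev5: "\<forall>\<^sub>F n in sequentially. \<beta> * \<kappa> / 2 * ln (real n) \<le> ln (1 / (Q * (ln (real n) / real n) powr (\<beta> * \<kappa>)))"
      by (rule log_inverse_amplitude_large[OF pos(3) \<beta>\<kappa>0])
    have ev6: "\<forall>\<^sub>F n in sequentially. Q * (ln (real n) / real n) powr (\<beta> * \<kappa>) < \<theta>0"
      by (rule order_tendstoD(2)[OF amplitude_tendsto_0[OF pos(3) \<beta>\<kappa>0] \<theta>0])
    have ev7: "\<forall>\<^sub>F n::nat in sequentially. ln (real n) \<ge> 1" by real_asymp
    show ?thesis
      using ev1 ev2 ev3 ev4 ev5 ev6 ev7 eventually_ge_at_top[of 1]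
    proof eventually_elim
      case (elim n)
      define e where "e = eps n"
      have e: "0 < e" "e < 1 / 2" "e < \<delta>\<^sub>0" using eps_pos[OF elim(8)] elim(3) by (auto simp: e_def)
      have lnpos: "ln (real n) > 0" using elim(7) by linarith
      have npos: "real n > 0" using elim(8) by simp
      have \<sigma>pos: "\<sigma> n > 0" and \<sigma>2: "(\<sigma> n)\<^sup>2 = ln (real n)" using lnpos by (auto simp: \<sigma>_def)
      define K where "K = exp (\<sigma> n)"
      have K: "K \<ge> 1" using \<sigma>pos by (simp add: K_def)
      define H where "H = 1 + C * K powr - s"
      obtain g where g: "g \<in> holder_class \<beta> H UNIV" "g 0 = \<gamma> 0" "\<forall>x. \<bar>g x\<bar> \<le> \<bar>\<gamma> x\<bar>" "\<forall>x. \<bar>g x\<bar> \<le> B"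
          "\<forall>x. \<bar>x\<bar> \<ge> K \<longrightarrow> g x = 0" "\<forall>x y. \<bar>g x - g y\<bar> \<le> B * \<bar>x - y\<bar> powr s"
        using trunc K unfolding H_def by blast
      have "continuous_on UNIV g" using g(6) s by (intro continuous_of_holder) auto
      then have [measurable]: "g \<in> borel_measurable borel" by (rule borel_measurable_continuous_onI)
      have gsq: "(g x)\<^sup>2 \<le> (\<gamma> x)\<^sup>2" for x using g(3) by (simp add: abs_le_square_iff)
      have g2: "integrable lborel (\<lambda>x. (g x)\<^sup>2)"
        by (rule Bochner_Integration.integrable_bound[OF \<gamma>int]) (use gsq in auto)
      have g2': "(LINT x|lborel. (g x)\<^sup>2) \<le> \<Gamma>"
        unfolding \<Gamma>_def by (rule integral_mono[OF g2 \<gamma>int gsq])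
      have "K powr - s \<le> 1" using K s by (simp add: powr_minus divide_simps ge_one_powr_ge_zero)
      then have H: "1 \<le> H" "H \<le> 1 + C" using C mult_left_mono[of "K powr - s" 1 C] by (auto simp: H_def)
      define \<rho> where "\<rho> = (ln (real n) / real n) powr (\<beta> / (2 * \<beta> + 1))"
      have \<rho>: "\<rho> > 0" using lnpos npos by (simp add: \<rho>_def)
      define a where "a = (1 - e) * d * \<rho>"
      have a: "a > 0" using e d \<rho> by (simp add: a_def)
      define b where "b = (a * H / L) powr (1 / \<beta>)"
      have b: "b > 0" using a H L by (simp add: b_def)
      have bL: "a * H \<le> L * b powr \<beta>" using a H L \<beta> by (simp add: b_def powr_powr)
      have bform: "b = ((1 - e) * d * H / L) powr (1 / \<beta>) * (ln (real n) / real n) powr \<kappa>"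
      proof -
        have "a * H / L = ((1 - e) * d * H / L) * \<rho>" by (simp add: a_def)
        moreover have "\<rho> powr (1 / \<beta>) = (ln (real n) / real n) powr \<kappa>"
          unfolding \<rho>_def \<beta>\<kappa> using \<beta> by (simp add: powr_powr)
        ultimately show ?thesis unfolding b_def by (simp only: powr_mult)
      qed
      have "bl n \<le> b"
      proof -
        have "1 / 2 * d * 1 \<le> (1 - e) * d * H" using e d H by (intro mult_mono) auto
        then have "d / (2 * L) \<le> (1 - e) * d * H / L" using L by (simp add: field_simps)
        then have "q1 \<le> ((1 - e) * d * H / L) powr (1 / \<beta>)"
          unfolding q1_def using d L \<beta> by (intro powr_mono2) auto
        then show ?thesis unfolding bl_def bform by (intro mult_right_mono) auto
      qed
      have bu: "b \<le> q2 * (ln (real n) / real n) powr \<kappa>"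
      proof -
        have "(1 - e) * d * H \<le> 1 * d * (1 + C)" using e d H C by (intro mult_mono) auto
        then have "(1 - e) * d * H / L \<le> (1 + C) * d / L" using L by (intro divide_right_mono) (auto simp: mult_ac)
        then have "((1 - e) * d * H / L) powr (1 / \<beta>) \<le> q2"
          unfolding q2_def using d L \<beta> e H by (intro powr_mono2) auto
        then show ?thesis unfolding bform by (intro mult_right_mono) auto
      qed
      have blpos: "bl n > 0" using pos lnpos npos by (simp add: bl_def)
      (* With this m, the m centres p + 2 * b * K * j, for j < m, lie between p and q. *)
      define m where "m = nat \<lfloor>(q - p) / (2 * b * K)\<rfloor>"
      have "exp (\<kappa> * ln (real n) - 2 * \<sigma> n) \<le> (q - p) / (2 * (q2 * (ln (real n) / real n) powr \<kappa>) * K) - 1"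
        using elim(4) by (simp add: K_def)
      also have "\<dots> \<le> (q - p) / (2 * b * K) - 1"
        using bu b K pq pos lnpos npos
        by (intro diff_right_mono divide_left_mono mult_right_mono mult_left_mono mult_pos_pos) auto
      also have "\<dots> \<le> real m" unfolding m_def by linarith
      finally have mlarge: "exp (\<kappa> * (\<sigma> n)\<^sup>2 - 2 * \<sigma> n) \<le> real m" unfolding \<sigma>2 .
      have mpos: "m > 0"
        using mlarge exp_gt_zero[of "\<kappa> * (\<sigma> n)\<^sup>2 - 2 * \<sigma> n"] by (cases m) auto
      have "real m \<le> (q - p) / (2 * b * K)"
        unfolding m_def using b K pq by (intro of_nat_floor) auto
      then have mfit: "2 * b * K * real m \<le> q - p" using b K by (simp add: field_simps)
      (* The factor of the squared shift in the moment bound for \<delta> = e / 2, with the upper bound for the remainder r in place of r. *)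
      define w where "w = e / 2 * (1 + e / 2) * (I / 2) * (1 + C' / ln (real n))"
      have w: "w \<ge> 0" using e I C' lnpos by (simp add: w_def)
      have amp: "a * B / sqrt c \<le> Q * (ln (real n) / real n) powr (\<beta> * \<kappa>)"
      proof -
        have "a \<le> d * \<rho>" using e d \<rho> by (simp add: a_def mult_le_cancel_right1)
        then have "a * B / sqrt c \<le> d * \<rho> * B / sqrt c" using B c by (intro divide_right_mono mult_right_mono) auto
        then show ?thesis unfolding Q_def \<rho>_def \<beta>\<kappa> by (simp add: mult_ac)
      qed
      have moment: "integrable lborel (\<lambda>z. ((f (z + \<theta>) / f z) powr (1 + e / 2) - 1) * f z) \<and>
         (LINT z|lborel. ((f (z + \<theta>) / f z) powr (1 + e / 2) - 1) * f z) \<le> w * \<theta>\<^sup>2"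
        if \<theta>: "\<theta> \<noteq> 0" "\<bar>\<theta>\<bar> \<le> a * B / sqrt c" for \<theta>
      proof -
        have le: "\<bar>\<theta>\<bar> \<le> Q * (ln (real n) / real n) powr (\<beta> * \<kappa>)" using \<theta> amp by linarith
        have ed: "e / 2 \<in> {0<..\<delta>\<^sub>0}" using e by auto
        have sm: "integrable lborel (\<lambda>z. ((f (z + \<theta>) / f z) powr (1 + e / 2) - 1) * f z)"
          "(LINT z|lborel. ((f (z + \<theta>) / f z) powr (1 + e / 2) - 1) * f z)
             = 1 / 2 * (e / 2) * (1 + e / 2) * \<theta>\<^sup>2 * I * (1 + r \<theta> (e / 2))"
          "\<bar>r \<theta> (e / 2)\<bar> \<le> Cr * (1 / ln (1 / \<bar>\<theta>\<bar>))"
          using small[OF \<theta>(1) _ ed] le elim(6) by auto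
        have "1 / (Q * (ln (real n) / real n) powr (\<beta> * \<kappa>)) \<le> 1 / \<bar>\<theta>\<bar>"
          using le \<theta>(1) pos npos lnpos by (intro divide_left_mono mult_pos_pos) auto
        then have "ln (1 / (Q * (ln (real n) / real n) powr (\<beta> * \<kappa>))) \<le> ln (1 / \<bar>\<theta>\<bar>)"
          using \<theta>(1) pos lnpos npos by (subst ln_le_cancel_iff) auto
        then have lnl: "\<beta> * \<kappa> / 2 * ln (real n) \<le> ln (1 / \<bar>\<theta>\<bar>)" using elim(5) by linarith
        have l0: "\<beta> * \<kappa> / 2 * ln (real n) > 0" using \<beta>\<kappa>0 lnpos by simp
        have "Cr * (1 / ln (1 / \<bar>\<theta>\<bar>)) \<le> \<bar>Cr\<bar> * (1 / (\<beta> * \<kappa> / 2 * ln (real n)))"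
        proof (rule mult_mono)
          show "1 / ln (1 / \<bar>\<theta>\<bar>) \<le> 1 / (\<beta> * \<kappa> / 2 * ln (real n))"
            by (rule divide_left_mono[OF lnl]) (use lnl l0 in \<open>auto intro!: mult_pos_pos\<close>)
          show "0 \<le> 1 / ln (1 / \<bar>\<theta>\<bar>)" using lnl l0 by (intro divide_nonneg_nonneg) linarith+
        qed auto
        also have "\<dots> = C' / ln (real n)" by (simp add: C'_def)
        finally have "1 + r \<theta> (e / 2) \<le> 1 + C' / ln (real n)" using sm(3) by linarith
        then have "1 / 2 * (e / 2) * (1 + e / 2) * \<theta>\<^sup>2 * I * (1 + r \<theta> (e / 2))
            \<le> 1 / 2 * (e / 2) * (1 + e / 2) * \<theta>\<^sup>2 * I * (1 + C' / ln (real n))"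
          using e I by (intro mult_left_mono) auto
        also have "\<dots> = w * \<theta>\<^sup>2" by (simp add: w_def)
        finally show ?thesis using sm(1,2) by simp
      qed
      define S where "S = real n * a\<^sup>2 * b * \<Gamma> * E n"
      have S: "real n * a\<^sup>2 * b * (\<Gamma> + 4 * B\<^sup>2 * (1 / (real n * c * b)) powr s * (K + 1 / (real n * c * b))
          + B\<^sup>2 * V / (c\<^sup>2 * real n * b)) \<le> S"
      proof -
        have y: "1 / (real n * c * b) \<le> 1 / (real n * c * bl n)"
          using \<open>bl n \<le> b\<close> blpos npos c by (intro divide_left_mono mult_left_mono mult_pos_pos) auto
        have y0: "0 \<le> 1 / (real n * c * b)" using b npos c by simp
        have z: "1 / (c\<^sup>2 * real n * b) \<le> 1 / (c\<^sup>2 * real n * bl n)"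
          using \<open>bl n \<le> b\<close> blpos npos c by (intro divide_left_mono mult_left_mono mult_pos_pos) auto
        have "4 * B\<^sup>2 * (1 / (real n * c * b)) powr s * (K + 1 / (real n * c * b))
            \<le> 4 * B\<^sup>2 * (1 / (real n * c * bl n)) powr s * (K + 1 / (real n * c * bl n))"
          using y y0 s K by (intro mult_mono powr_mono2 add_mono) auto
        moreover have "B\<^sup>2 * V * (1 / (c\<^sup>2 * real n * b)) \<le> B\<^sup>2 * V * (1 / (c\<^sup>2 * real n * bl n))"
          using z V0 by (intro mult_left_mono) auto
        moreover have "\<Gamma> * E n = \<Gamma> + 4 * B\<^sup>2 * (1 / (real n * c * bl n)) powr s * (K + 1 / (real n * c * bl n))
            + B\<^sup>2 * V * (1 / (c\<^sup>2 * real n * bl n))"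
          using \<Gamma> by (simp add: E_def A_def A'_def K_def distrib_left mult.assoc)
        ultimately have "\<Gamma> + 4 * B\<^sup>2 * (1 / (real n * c * b)) powr s * (K + 1 / (real n * c * b))
          + B\<^sup>2 * V / (c\<^sup>2 * real n * b) \<le> \<Gamma> * E n" by simp
        then have "real n * a\<^sup>2 * b * (\<Gamma> + 4 * B\<^sup>2 * (1 / (real n * c * b)) powr s * (K + 1 / (real n * c * b))
          + B\<^sup>2 * V / (c\<^sup>2 * real n * b)) \<le> real n * a\<^sup>2 * b * (\<Gamma> * E n)"
          using b npos by (intro mult_left_mono) auto
        then show ?thesis by (simp add: S_def mult_ac)
      qed
      have wS: "w * S \<le> e / 2 * (1 + e / 2) * ((1 - e) * (\<kappa> * (\<sigma> n)\<^sup>2))"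
      proof -
        have energy: "I / 2 * (real n * a\<^sup>2 * b * \<Gamma>) = (1 - e) powr (2 + 1 / \<beta>) * H powr (1 / \<beta>) * (ln (real n) / (2 * \<beta> + 1))"
          unfolding b_def a_def \<rho>_def dI
          by (rule signal_energy_eq) (use \<beta> L I \<Gamma> e H npos lnpos in auto)
        define T where "T = H powr (1 / \<beta>) * E n * (1 + C' / ln (real n))"
        have "\<sigma> n * (T - 1) < 1" using elim(1) unfolding T_def H_def K_def .
        then have "\<sigma> n * (T - 1) < \<sigma> n * e" using elim(2) unfolding e_def by linarith
        then have T: "T \<le> 1 + e" using \<sigma>pos by (simp add: mult_less_cancel_left_pos)
        (* Of the gain from lowering the amplitude, one factor 1 - e pays for the corrections T \<le> 1 + e
           and one is kept. *)
        have "(1 - e) powr (2 + 1 / \<beta>) \<le> (1 - e) powr 2" using e \<beta> by (intro powr_mono') auto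
        then have pw: "(1 - e) powr (2 + 1 / \<beta>) \<le> (1 - e)\<^sup>2" using e by simp
        have "(1 - e) powr (2 + 1 / \<beta>) * T \<le> (1 - e) powr (2 + 1 / \<beta>) * (1 + e)"
          using T by (intro mult_left_mono) auto
        also have "\<dots> \<le> (1 - e)\<^sup>2 * (1 + e)" using pw e by (intro mult_right_mono) auto
        also have "\<dots> = (1 - e) * (1 - e\<^sup>2)" by (simp add: power2_eq_square algebra_simps)
        also have "\<dots> \<le> (1 - e) * 1" using e by (intro mult_left_mono) auto
        finally have fac: "(1 - e) powr (2 + 1 / \<beta>) * T \<le> 1 - e" by simp
        have "w * S = e / 2 * (1 + e / 2) * ((1 + C' / ln (real n)) * E n * (I / 2 * (real n * a\<^sup>2 * b * \<Gamma>)))"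
          by (simp add: w_def S_def mult_ac)
        also have "\<dots> = e / 2 * (1 + e / 2) * (((1 - e) powr (2 + 1 / \<beta>) * T) * (\<kappa> * (\<sigma> n)\<^sup>2))"
          unfolding energy \<sigma>2 by (simp add: T_def \<kappa>_def mult_ac)
        also have "\<dots> \<le> e / 2 * (1 + e / 2) * ((1 - e) * (\<kappa> * (\<sigma> n)\<^sup>2))"
          using fac e \<kappa> by (intro mult_left_mono mult_right_mono) auto
        finally show ?thesis .
      qed
      have "\<exists>l \<in> weighted_holder_class h \<beta> L. sup_norm_on J (\<lambda>x. l x * sqrt (h x)) \<ge> a \<and>
         expectation_under (M n) h (\<epsilon> n) n l (\<phi> n) \<le> expectation_under (M n) h (\<epsilon> n) n (\<lambda>_. 0) (\<phi> n)
           + sqrt (real m powr - (e / 2) * exp (w * S)) + real m powr - (e / 2) * exp (w * S)"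
      proof (rule exists_undetectable_bump[where K = K and B = B and s = s and \<Gamma> = \<Gamma> and p = p and q = q
              and b = b and g = g and f = f and V = V and w = w and S = S, OF hpos hc h1 elim(8) V c g(1)])
        show "g 0 \<ge> 1" using g(2) \<gamma>(2) by simp
        show "0 < s" by (rule s(1))
        show "a \<ge> 0" using a by simp
        show "K \<ge> 0" using K by simp
        show "prob_space (M n)" by (rule prob[OF elim(8)])
        show "prob_space.indep_vars (M n) (\<lambda>_. borel) (\<epsilon> n) {1..n}" by (rule ind[OF elim(8)])
        show "is_test n (\<phi> n)" by (rule test[OF elim(8)])
        show "0 < e / 2" "e / 2 \<le> 1" using e by auto
        show "\<bar>g x\<bar> \<le> B" for x using g(4) by blast
        show "\<bar>g x - g y\<bar> \<le> B * \<bar>x - y\<bar> powr s" for x y using g(6) by blast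
        show "g x = 0" if "K \<le> \<bar>x\<bar>" for x using g(5) that by blast
        show "distributed (M n) lborel (\<epsilon> n i) (\<lambda>x. ennreal (f x))" if "i \<in> {1..n}" for i
          by (rule dist[OF elim(8) that])
        show "f x > 0" for x by (rule fpos)
      qed (assumption | fact g2 g2' b bL J pq mpos mfit w moment S)+
      then obtain l where l: "l \<in> weighted_holder_class h \<beta> L" "sup_norm_on J (\<lambda>x. l x * sqrt (h x)) \<ge> a"
        "expectation_under (M n) h (\<epsilon> n) n l (\<phi> n) \<le> expectation_under (M n) h (\<epsilon> n) n (\<lambda>_. 0) (\<phi> n)
           + sqrt (real m powr - (e / 2) * exp (w * S)) + real m powr - (e / 2) * exp (w * S)" by blast
      have "real m powr - (e / 2) * exp (w * S) \<le> err n"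
        unfolding err_def e_def[symmetric]
        by (rule likelihood_moment_negligible[OF _ _ \<kappa>(1) \<sigma>pos mlarge wS]) (use e in auto)
      moreover from this have "sqrt (real m powr - (e / 2) * exp (w * S)) \<le> sqrt (err n)" by simp
      ultimately have "expectation_under (M n) h (\<epsilon> n) n l (\<phi> n) \<le> \<alpha> + sqrt (err n) + err n"
        using l(3) level[OF elim(8)] by linarith
      moreover have "l \<in> alternatives n"
        using l(1,2) by (simp add: alternatives_def a_def \<rho>_def e_def rate_def)
      ultimately show ?case by blast
    qed
  qed
  have "((\<lambda>u. exp (- (u / 2) * (u * \<kappa> / 2 - 2))) \<longlongrightarrow> 0) at_top" using \<kappa>(1) by real_asymp
  from filterlim_compose[OF this eps_log] have err0: "err \<longlonglongrightarrow> 0"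
    unfolding err_def[abs_def] \<sigma>_def .
  have "(\<lambda>n. \<alpha> + sqrt (err n) + err n) \<longlonglongrightarrow> \<alpha> + sqrt 0 + 0"
    by (intro tendsto_intros err0)
  then have "(\<lambda>n. ereal (\<alpha> + sqrt (err n) + err n)) \<longlonglongrightarrow> ereal \<alpha>" by simp
  then have lim: "limsup (\<lambda>n. ereal (\<alpha> + sqrt (err n) + err n)) = ereal \<alpha>"
    by (intro lim_imp_Limsup) auto
  have "limsup (\<lambda>n. INF l \<in> alternatives n. ereal (expectation_under (M n) h (\<epsilon> n) n l (\<phi> n)))
      \<le> limsup (\<lambda>n. ereal (\<alpha> + sqrt (err n) + err n))"
  proof (rule Limsup_mono)
    show "\<forall>\<^sub>F n in sequentially. (INF l \<in> alternatives n. ereal (expectation_under (M n) h (\<epsilon> n) n l (\<phi> n)))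
        \<le> ereal (\<alpha> + sqrt (err n) + err n)"
      using main
    proof eventually_elim
      case (elim n)
      then obtain l where l: "l \<in> alternatives n"
        "expectation_under (M n) h (\<epsilon> n) n l (\<phi> n) \<le> \<alpha> + sqrt (err n) + err n" by blast
      show ?case by (rule INF_lower2[OF l(1)]) (use l(2) in simp)
    qed
  qed
  then show ?thesis unfolding lim alternatives_def d_def .
qed

end
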